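(* Let $a_n\to\infty$ be a sequence of positive numbers, and let $(X_n)_{n\in\mathbb{N}}$ be a sequence of random matrices with $X_n\in M_n^{sa}$ such that $X_n\in\mathcal{S}(d_n)$ for every $n$ with $d_n=O(n^2/a_n^2)$. Assume $(X_n)_{n\in\mathbb{N}}$ has property $\mathcal{L}(a_n)$. Then for every $f\in C_c(\mathbb{R})\cap C_L(\mathbb{R})$, \[ \int f\,dL_n^{\frac1{\sqrt n}X_n}-\mathbb{E}\int f\,dL_n^{\frac1{\sqrt n}X_n}\to0\quad\text{in probability}. \]
   Context: $M_n^{sa}$ denotes the space of $n\times n$ complex Hermitian matrices. For a random Hermitian $n\times n$ matrix $X$ with eigenvalues $\lambda_1\le\dots\le\lambda_n$, $L_n^X=\frac1n\sum_{i=1}^n\delta_{\lambda_i}$. A random $n\times m$ matrix $X$ satisfies $\mathcal{S}(d)$ if there is a partition $\{P_1,\dots,P_k\}$ of $\{1,\dots,n\}\times\{1,\dots,m\}$ such that the random vectors $\{X_{ij}\}_{(i,j)\in P_r}$, $r=1,\dots,k$, are mutually independent and $|P_r|\le d$ for all $r$. A sequence of random matrices $X_n\in M_n$ has property $\mathcal{L}(a_n)$ if for every $\varepsilon>0$, \[ \limsup_{n\to\infty}\mathbb{P}\Big(\frac1{n^2}\sum_{i,j=1}^n|(X_n)_{ij}|^2\mathbf{1}_{\{|(X_n)_{ij}|>\varepsilon a_n\}}>\varepsilon\Big)=0. \] $C_c(\mathbb{R})$ denotes real compactly supported continuous functions, $C_L(\mathbb{R})$ real 1-Lipschitz functions on $\mathbb{R}$.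 *)

theory Defs
  imports "HOL-Probability.Probability" "Jordan_Normal_Form.Char_Poly" "HOL-Library.Landau_Symbols"
begin

definition hermitian_mat :: "nat \<Rightarrow> complex mat \<Rightarrow> bool" where
  "hermitian_mat n A \<longleftrightarrow> A \<in> carrier_mat n n \<and>
     (\<forall>i<n. \<forall>j<n. A $$ (j, i) = cnj (A $$ (i, j)))"

text \<open>Integral of f against the empirical spectral distribution L_n^A
  = (1/n) sum_i delta_{lambda_i}, eigenvalues counted with multiplicity
  (roots of the characteristic polynomial; real for Hermitian A).\<close>
definition esd_integral :: "(real \<Rightarrow> real) \<Rightarrow> complex mat \<Rightarrow> real" where
  "esd_integral f A =
     (1 / real (dim_row A)) * sum_mset (image_mset (\<lambda>z. f (Re z)) (proots (char_poly A)))"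

definition prop_S :: "'a measure \<Rightarrow> nat \<Rightarrow> nat \<Rightarrow> ('a \<Rightarrow> complex mat) \<Rightarrow> nat \<Rightarrow> bool" where
  "prop_S M n m X d \<longleftrightarrow> (\<exists>P. partition_on ({..<n} \<times> {..<m}) P \<and> (\<forall>B\<in>P. card B \<le> d) \<and>
      prob_space.indep_vars M (\<lambda>B. PiM B (\<lambda>_. (borel :: complex measure)))
        (\<lambda>B \<omega>. restrict (\<lambda>ij. X \<omega> $$ ij) B) P)"

definition prop_L :: "(nat \<Rightarrow> 'a measure) \<Rightarrow> (nat \<Rightarrow> 'a \<Rightarrow> complex mat) \<Rightarrow> (nat \<Rightarrow> real) \<Rightarrow> bool" where
  "prop_L M X a \<longleftrightarrow> (\<forall>\<epsilon>>0. limsup (\<lambda>n. ereal (measure (M n)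
      {\<omega> \<in> space (M n). (1 / real n ^ 2) * (\<Sum>i<n. \<Sum>j<n.
          (cmod (X n \<omega> $$ (i, j)))\<^sup>2 * (if cmod (X n \<omega> $$ (i, j)) > \<epsilon> * a n then 1 else 0)) > \<epsilon>})) = 0)"

end

theory Submission
  imports Defs "Jordan_Normal_Form.Schur_Decomposition"
begin

text \<open>
  For Hermitian \<open>A\<close> the map \<open>A \<mapsto> \<integral> \<bar>z - t\<bar> dL\<^sub>n\<close> of \<open>A / sqrt n\<close> is convex with a subgradient
  (a multiple of \<open>sgn (A / sqrt n - t)\<close>) of Frobenius norm at most \<open>1 / n\<close>. If the entries are bounded by
  \<open>r\<close> and independent across blocks of size at most \<open>d\<close>, the one-sided Efron--Stein inequality applied
  to the blocks therefore bounds its variance by \<open>4 r\<^sup>2 d / n\<^sup>2\<close>: by convexity the positive part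
  of the increment caused by resampling a block is at most the norm of the subgradient on that block
  times \<open>2 r sqrt d\<close>, and the squared norms over the blocks add up to at most \<open>1 / n\<^sup>2\<close>.

  Truncating the entries at \<open>\<epsilon> a\<^sub>n\<close> changes the statistic by at most \<open>sqrt \<epsilon>\<close> off an event whose
  probability tends to \<open>0\<close> by property \<open>L(a\<^sub>n)\<close>, while \<open>d\<^sub>n = O(n\<^sup>2 / a\<^sub>n\<^sup>2)\<close> makes the variance of the
  truncated statistic \<open>O(\<epsilon>\<^sup>2)\<close>. A compactly supported Lipschitz function is a uniform limit of
  finite combinations of the functions \<open>\<bar>z - t\<bar>\<close>, so the \<open>L\<^sup>1\<close> deviation of \<open>\<integral> f dL\<^sub>n\<close> from its mean
  tends to \<open>0\<close>. Arbitrary block structures may destroy Hermitian symmetry when a single block is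
  resampled; the statistic is therefore defined on all arrays, through the Hermitian part.
\<close>

unbundle no vec_syntax

subsection \<open>Unitary diagonalisation of Hermitian matrices\<close>

definition cadj :: "complex mat \<Rightarrow> complex mat" where
  "cadj A = mat (dim_col A) (dim_row A) (\<lambda>(i, j). cnj (A $$ (j, i)))"

lemma cadj_carrier [simp]: "A \<in> carrier_mat n m \<Longrightarrow> cadj A \<in> carrier_mat m n"
  by (auto simp: cadj_def)

lemma cadj_index [simp]:
  "i < dim_col A \<Longrightarrow> j < dim_row A \<Longrightarrow> cadj A $$ (i, j) = cnj (A $$ (j, i))"
  by (simp add: cadj_def)

lemma cadj_dim [simp]: "dim_row (cadj A) = dim_col A" "dim_col (cadj A) = dim_row A"
  by (simp_all add: cadj_def)

lemma cadj_cadj [simp]: "cadj (cadj A) = A"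
  by (rule eq_matI) auto

lemma cadj_mult:
  assumes "A \<in> carrier_mat n m" "B \<in> carrier_mat m k"
  shows "cadj (A * B) = cadj B * cadj A"
  using assms by (intro eq_matI) (auto simp: scalar_prod_def intro!: sum.cong)

lemma hermitian_mat_cadj_iff: "hermitian_mat n A \<longleftrightarrow> A \<in> carrier_mat n n \<and> cadj A = A"
proof (cases "A \<in> carrier_mat n n")
  case True
  then have d: "dim_row A = n" "dim_col A = n" by auto
  have "cadj A = A \<longleftrightarrow> (\<forall>i<n. \<forall>j<n. cnj (A $$ (j, i)) = A $$ (i, j))"
    using d by (simp add: mat_eq_iff)
  also have "\<dots> \<longleftrightarrow> (\<forall>i<n. \<forall>j<n. A $$ (j, i) = cnj (A $$ (i, j)))"
    by metis
  finally have "cadj A = A \<longleftrightarrow> (\<forall>i<n. \<forall>j<n. A $$ (j, i) = cnj (A $$ (i, j)))" .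
  then show ?thesis using True by (simp add: hermitian_mat_def)
qed (auto simp: hermitian_mat_def)

text \<open>Supplies the deflation step of the spectral theorem. A root of the characteristic
  polynomial gives an eigenvector; after completion to a basis, Gram-Schmidt keeps it as the first
  vector.\<close>

lemma exists_unitary_first_col_eigenvector:
  assumes A: "(A :: complex mat) \<in> carrier_mat n n" and n: "n \<noteq> 0"
  obtains U e where "U \<in> carrier_mat n n" "cadj U * U = 1\<^sub>m n"
    "\<And>i. i < n \<Longrightarrow> (A * U) $$ (i, 0) = e * U $$ (i, 0)"
proof -
  obtain es where es: "char_poly A = (\<Prod>a\<leftarrow>es. [:- a, 1:])" "length es = n"
    using char_poly_factorized[OF A] by blast
  with n obtain e es' where "es = e # es'" by (cases es) auto
  then have ev: "eigenvalue A e" by (simp add: eigenvalue_root_char_poly[OF A] es)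
  then obtain v where "eigenvector A v e" by (auto simp: eigenvalue_def)
  with A have v: "v \<in> carrier_vec n" "v \<noteq> 0\<^sub>v n" "A *\<^sub>v v = e \<cdot>\<^sub>v v"
    by (auto simp: eigenvector_def)
  interpret cof_vec_space n "TYPE(complex)" .
  define b where "b = basis_completion v"
  define ws where "ws = gram_schmidt n b"
  from basis_completion[OF v(1,2), folded b_def]
  have dist_b: "distinct b" and indep: "\<not> lin_dep (set b)" and b: "set b \<subseteq> carrier_vec n"
    and hdb: "hd b = v" and len_b: "length b = n" by auto
  from hdb len_b n obtain vs where bv: "b = v # vs" by (cases b, auto)
  from gram_schmidt_result[OF b dist_b indep refl, folded ws_def]
  have ws: "set ws \<subseteq> carrier_vec n" "corthogonal ws" "length ws = n" by (auto simp: len_b)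
  from gram_schmidt_hd[OF v(1), of vs, folded bv] have "hd ws = v" unfolding ws_def .
  then have ws0: "ws ! 0 = v" using ws(3) n by (cases ws) auto
  have wsc: "ws ! j \<in> carrier_vec n" if "j < n" for j using ws that by auto
  \<comment> \<open>Gram-Schmidt yields orthogonal vectors without normalising them, so column
    \<open>j\<close> of \<open>U\<close> is divided by its Euclidean norm
    \<open>r j\<close>.\<close>
  define r where "r j = sqrt (\<Sum>k<n. (cmod (ws ! j $ k))\<^sup>2)" for j
  have sp: "ws ! j \<bullet>c ws ! i = (\<Sum>k<n. ws ! j $ k * cnj (ws ! i $ k))" if "i < n" "j < n" for i j
    using wsc[OF that(1)] wsc[OF that(2)] by (simp add: scalar_prod_def atLeast0LessThan)
  have orth: "(\<Sum>k<n. ws ! j $ k * cnj (ws ! i $ k)) = 0 \<longleftrightarrow> i \<noteq> j" if "i < n" "j < n" for i j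
    using corthogonalD[OF ws(2), of j i] that sp[OF that] ws(3) by auto
  have rsq: "(\<Sum>k<n. ws ! j $ k * cnj (ws ! j $ k)) = of_real ((r j)\<^sup>2)" for j
    by (simp add: r_def real_sqrt_pow2 sum_nonneg complex_norm_square del: of_real_power)
  have r0: "r j \<noteq> 0" if "j < n" for j
    using orth[OF that that] rsq[of j] by auto
  define U where "U = mat n n (\<lambda>(i, j). ws ! j $ i / of_real (r j))"
  have U: "U \<in> carrier_mat n n" by (simp add: U_def)
  show thesis
  proof (rule that[OF U])
    show "cadj U * U = 1\<^sub>m n"
    proof (rule eq_matI)
      fix i j assume "i < dim_row (1\<^sub>m n :: complex mat)" "j < dim_col (1\<^sub>m n :: complex mat)"
      then have ij: "i < n" "j < n" by auto
      have "(cadj U * U) $$ (i, j) = (\<Sum>k<n. (ws ! j $ k * cnj (ws ! i $ k)) / of_real (r i * r j))"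
        using ij by (auto simp: U_def scalar_prod_def atLeast0LessThan field_simps intro!: sum.cong)
      also have "\<dots> = (\<Sum>k<n. ws ! j $ k * cnj (ws ! i $ k)) / of_real (r i * r j)"
        by (simp add: sum_divide_distrib)
      also have "\<dots> = 1\<^sub>m n $$ (i, j)"
      proof (cases "i = j")
        case True
        show ?thesis using ij r0[OF ij(1)] unfolding True rsq by (simp add: power2_eq_square)
      next
        case False
        with orth[OF ij] ij show ?thesis by simp
      qed
      finally show "(cadj U * U) $$ (i, j) = 1\<^sub>m n $$ (i, j)" .
    qed (auto simp: U_def)
    fix i assume i: "i < n"
    have "(A * U) $$ (i, 0) = (\<Sum>k<n. A $$ (i, k) * v $ k) / of_real (r 0)"
      using A i n by (auto simp: U_def scalar_prod_def atLeast0LessThan ws0 sum_divide_distrib intro!: sum.cong)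
    also have "(\<Sum>k<n. A $$ (i, k) * v $ k) = (A *\<^sub>v v) $ i"
      using A i v(1) by (auto simp: scalar_prod_def atLeast0LessThan)
    also have "\<dots> = e * v $ i" using i v by simp
    finally show "(A * U) $$ (i, 0) = e * U $$ (i, 0)"
      using i n by (simp add: U_def ws0)
  qed
qed

definition rdiag :: "nat \<Rightarrow> (nat \<Rightarrow> real) \<Rightarrow> complex mat" where
  "rdiag n l = mat n n (\<lambda>(i, j). if i = j then of_real (l i) else 0)"

lemma rdiag_carrier [simp]: "rdiag n l \<in> carrier_mat n n"
  by (simp add: rdiag_def)


lemma four_block_diag_mult:
  assumes "A1 \<in> carrier_mat k k" "A2 \<in> carrier_mat m m" "B1 \<in> carrier_mat k k" "B2 \<in> carrier_mat m m"
  shows "four_block_mat A1 (0\<^sub>m k m) (0\<^sub>m m k) A2 * four_block_mat B1 (0\<^sub>m k m) (0\<^sub>m m k) B2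
    = four_block_mat (A1 * B1) (0\<^sub>m k m) (0\<^sub>m m k) (A2 * (B2 :: complex mat))"
  using assms by (subst mult_four_block_mat[of _ k k _ m _ m _ _ k _ m]) auto

lemma unitary_conj_hermitian:
  assumes U: "U \<in> carrier_mat n n" and A: "A \<in> carrier_mat n n" and UU: "U * cadj U = 1\<^sub>m n"
    and hA: "cadj A = A"
  shows "cadj (cadj U * (A * U)) = cadj U * (A * U)" "A = U * (cadj U * (A * U)) * cadj U"
proof -
  note cU = cadj_carrier[OF U]
  have AU: "A * U \<in> carrier_mat n n" using A U by simp
  show "cadj (cadj U * (A * U)) = cadj U * (A * U)"
    unfolding cadj_mult[OF cU AU] cadj_mult[OF A U] hA cadj_cadj by (rule assoc_mult_mat[OF cU A U])
  have "U * (cadj U * (A * U)) = A * U"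
    unfolding assoc_mult_mat[OF U cU AU, symmetric] UU by (rule left_mult_one_mat[OF AU])
  then show "A = U * (cadj U * (A * U)) * cadj U"
    using assoc_mult_mat[OF A U cU] A by (simp add: UU)
qed

lemma unitary_mult:
  assumes U: "U \<in> carrier_mat n n" and Q: "Q \<in> carrier_mat n n"
    and UU: "cadj U * U = 1\<^sub>m n" and QQ: "cadj Q * Q = 1\<^sub>m n"
  shows "cadj (U * Q) * (U * Q) = 1\<^sub>m n"
proof -
  note cU = cadj_carrier[OF U] and cQ = cadj_carrier[OF Q]
  have "cadj Q * cadj U * (U * Q) = cadj Q * (cadj U * (U * Q))"
    by (rule assoc_mult_mat[OF cQ cU mult_carrier_mat[OF U Q]])
  also have "cadj U * (U * Q) = Q"
    using assoc_mult_mat[OF cU U Q] Q by (simp add: UU)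
  finally show ?thesis by (simp add: cadj_mult[OF U Q] QQ)
qed

lemma unitary_conj_comp:
  assumes "U \<in> carrier_mat n n" "Q \<in> carrier_mat n n" "D \<in> carrier_mat n n"
  shows "U * (Q * D * cadj Q) * cadj U = U * Q * D * cadj (U * Q)"
proof -
  note c = assms cadj_carrier[OF assms(1)] cadj_carrier[OF assms(2)]
  have QD: "Q * D \<in> carrier_mat n n" and UQ: "U * Q \<in> carrier_mat n n" and UQD: "U * Q * D \<in> carrier_mat n n"
    using c by auto
  have "U * (Q * D * cadj Q) = U * (Q * D) * cadj Q" by (rule assoc_mult_mat[OF c(1) QD c(5), symmetric])
  also have "U * (Q * D) = U * Q * D" by (rule assoc_mult_mat[OF c(1-3), symmetric])
  finally show ?thesis
    by (simp add: cadj_mult[OF assms(1,2)] assoc_mult_mat[OF UQD c(5) c(4)])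
qed

text \<open>Induction on the dimension by deflation: conjugating by a unitary matrix whose first
  column is an eigenvector clears the first column below the diagonal, Hermitian symmetry then
  clears the first row, and the remaining block is Hermitian of size \<open>m\<close>.\<close>

theorem hermitian_spectral:
  assumes "hermitian_mat n A"
  obtains P l where "P \<in> carrier_mat n n" "cadj P * P = 1\<^sub>m n" "A = P * rdiag n l * cadj P"
proof -
  have "\<exists>P l. P \<in> carrier_mat n n \<and> cadj P * P = 1\<^sub>m n \<and> A = P * rdiag n l * cadj P"
    using assms
  proof (induction n arbitrary: A)
    case 0
    then have "A = 1\<^sub>m 0 * rdiag 0 (\<lambda>_. 0) * cadj (1\<^sub>m 0)"
      by (intro eq_matI) (auto simp: hermitian_mat_def)
    then show ?case
      by (intro exI[of _ "1\<^sub>m 0"] exI[of _ "\<lambda>_. 0"] conjI) (auto intro: eq_matI)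
  next
    case (Suc m)
    define n where n: "n = Suc m"
    from Suc.prems have A: "A \<in> carrier_mat n n" and hA: "cadj A = A"
      by (auto simp: hermitian_mat_cadj_iff n)
    have n0: "n \<noteq> 0" "0 < n" by (simp_all add: n)
    obtain U e where U: "U \<in> carrier_mat n n" and UU: "cadj U * U = 1\<^sub>m n"
      and ev: "\<And>i. i < n \<Longrightarrow> (A * U) $$ (i, 0) = e * U $$ (i, 0)"
      using exists_unitary_first_col_eigenvector[OF A n0(1)] by blast
    have cU: "cadj U \<in> carrier_mat n n" using U by simp
    have UU': "U * cadj U = 1\<^sub>m n" using mat_mult_left_right_inverse[OF cU U UU] .
    define B where "B = cadj U * (A * U)"
    have B: "B \<in> carrier_mat n n" unfolding B_def by (intro mult_carrier_mat[of _ n n] U A cU)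
    have hB: "cadj B = B" and AB: "A = U * B * cadj U"
      unfolding B_def using unitary_conj_hermitian[OF U A UU' hA] by auto
    have hB': "B $$ (j, i) = cnj (B $$ (i, j))" if "i < n" "j < n" for i j
      using that hB B by (metis cadj_index carrier_matD)
    \<comment> \<open>The first column of \<open>A * U\<close> is \<open>e\<close> times that of
      \<open>U\<close>, so the first column of \<open>B\<close> is \<open>e\<close> times that of
      \<open>cadj U * U\<close>, which is the identity.\<close>
    have B0: "B $$ (i, 0) = (if i = 0 then e else 0)" if i: "i < n" for i
    proof -
      have "B $$ (i, 0) = (\<Sum>k<n. cadj U $$ (i, k) * (A * U) $$ (k, 0))"
        using i U A cU n0 unfolding B_def
        by (subst index_mult_mat) (auto simp: scalar_prod_def atLeast0LessThan)
      also have "\<dots> = e * (\<Sum>k<n. cadj U $$ (i, k) * U $$ (k, 0))"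
        unfolding sum_distrib_left by (intro sum.cong refl) (auto simp: ev)
      also have "(\<Sum>k<n. cadj U $$ (i, k) * U $$ (k, 0)) = (cadj U * U) $$ (i, 0)"
        using i U cU n0 by (subst index_mult_mat) (auto simp: scalar_prod_def atLeast0LessThan)
      finally show ?thesis using i n0 by (simp add: UU)
    qed
    \<comment> \<open>\<open>e\<close> is a diagonal entry of the Hermitian matrix \<open>B\<close>,
      hence real.\<close>
    have e: "e = of_real (Re e)"
      using hB'[of 0 0] B0[of 0] n0 by (simp add: complex_eq_iff)
    have B0': "B $$ (0, i) = (if i = 0 then e else 0)" if i: "i < n" for i
      using hB'[OF i n0(2)] B0[OF i] B0[of 0] that e by (cases "i = 0") auto
    define C where "C = mat m m (\<lambda>(i, j). B $$ (Suc i, Suc j))"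
    have "hermitian_mat m C"
      unfolding hermitian_mat_def C_def by (auto intro!: hB' simp: n)
    from Suc.IH[OF this] obtain P' l' where P': "P' \<in> carrier_mat m m" "cadj P' * P' = 1\<^sub>m m"
      and C: "C = P' * rdiag m l' * cadj P'" by blast
    define Q where "Q = four_block_mat (1\<^sub>m 1) (0\<^sub>m 1 m) (0\<^sub>m m 1) P'"
    define l where "l i = (case i of 0 \<Rightarrow> Re e | Suc k \<Rightarrow> l' k)" for i
    have Q: "Q \<in> carrier_mat n n" using P' by (auto simp: Q_def n)
    have cQ: "cadj Q = four_block_mat (1\<^sub>m 1) (0\<^sub>m 1 m) (0\<^sub>m m 1) (cadj P')"
      using P' unfolding Q_def by (intro eq_matI) (auto simp: four_block_mat_def)
    have one: "four_block_mat (1\<^sub>m 1) (0\<^sub>m 1 m) (0\<^sub>m m 1) (1\<^sub>m m) = (1\<^sub>m n :: complex mat)"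
      by (intro eq_matI) (auto simp: four_block_mat_def n)
    have QQ: "cadj Q * Q = 1\<^sub>m n"
      unfolding cQ unfolding Q_def using P'
      by (subst four_block_diag_mult) (auto simp: one[unfolded n] n)
    have rd: "rdiag n l = four_block_mat (mat 1 1 (\<lambda>_. of_real (Re e))) (0\<^sub>m 1 m) (0\<^sub>m m 1) (rdiag m l')"
      by (intro eq_matI) (auto simp: four_block_mat_def rdiag_def l_def n split: nat.split)
    have Bb: "B = four_block_mat (mat 1 1 (\<lambda>_. e)) (0\<^sub>m 1 m) (0\<^sub>m m 1) C"
      using B by (intro eq_matI) (auto simp: four_block_mat_def C_def B0 B0' n)
    have QB: "B = Q * rdiag n l * cadj Q"
      unfolding cQ unfolding Q_def rd Bb C using P' e
      by (subst four_block_diag_mult, simp_all del: One_nat_def)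
        (subst four_block_diag_mult, auto simp del: One_nat_def intro!: mult_carrier_mat[of _ m m])
    show ?case
      unfolding n[symmetric]
    proof (intro exI conjI)
      show "U * Q \<in> carrier_mat n n" using U Q by simp
      show "cadj (U * Q) * (U * Q) = 1\<^sub>m n" by (rule unitary_mult[OF U Q UU QQ])
      show "A = U * Q * rdiag n l * cadj (U * Q)"
        by (subst AB, subst QB, rule unitary_conj_comp[OF U Q]) simp
    qed
  qed
  with that show thesis by blast
qed

subsection \<open>The subgradient of the trace norm\<close>

definition unitary_diag :: "nat \<Rightarrow> complex mat \<Rightarrow> complex mat \<Rightarrow> (nat \<Rightarrow> real) \<Rightarrow> bool" where
  "unitary_diag n A P l \<longleftrightarrow>
     P \<in> carrier_mat n n \<and> cadj P * P = 1\<^sub>m n \<and> A = P * rdiag n l * cadj P"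

text \<open>Similar matrices share their characteristic polynomial, and for a diagonal matrix its
  roots with multiplicity are the diagonal entries. This replaces the multiset of roots by an
  indexed sum.\<close>

lemma esd_integral_unitary_diag:
  assumes "unitary_diag n A P l"
  shows "esd_integral f A = (\<Sum>k<n. f (l k)) / real n"
proof -
  have P: "P \<in> carrier_mat n n" and PP: "cadj P * P = 1\<^sub>m n" and A: "A = P * rdiag n l * cadj P"
    using assms by (auto simp: unitary_diag_def)
  have cP: "cadj P \<in> carrier_mat n n" using P by simp
  have Ac: "A \<in> carrier_mat n n" unfolding A by (intro mult_carrier_mat[of _ n n] P cP) simp
  have "similar_mat A (rdiag n l)"
    unfolding similar_mat_def
    by (intro exI, rule similar_mat_witI[OF mat_mult_left_right_inverse[OF cP P PP] PP A Ac _ P cP]) simp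
  then have "char_poly A = char_poly (rdiag n l)" by (rule char_poly_similar)
  also have "\<dots> = (\<Prod>a\<leftarrow>diag_mat (rdiag n l). [:- a, 1:])"
    by (rule char_poly_upper_triangular[of _ n]) (auto simp: rdiag_def)
  also have "diag_mat (rdiag n l) = map (\<lambda>k. of_real (l k)) [0..<n]"
    by (auto simp: diag_mat_def rdiag_def)
  finally have "char_poly A = (\<Prod>p\<leftarrow>map (\<lambda>k. [:- of_real (l k), 1:]) [0..<n]. p)"
    by (simp add: o_def)
  then have "proots (char_poly A) = (\<Sum>p\<leftarrow>map (\<lambda>k. [:- of_real (l k), 1:]) [0..<n]. proots p)"
    by (simp only:) (rule proots_prod_list, auto)
  also have "\<dots> = mset (map (\<lambda>k. of_real (l k)) [0..<n])"
    by (induction n) (auto simp: o_def)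
  finally have pr: "proots (char_poly A) = mset (map (\<lambda>k. of_real (l k)) [0..<n])" .
  have "sum_mset (image_mset (\<lambda>z. f (Re z)) (proots (char_poly A))) = sum_list (map (\<lambda>k. f (l k)) [0..<n])"
    unfolding pr mset_map[symmetric] sum_mset_sum_list by (simp add: o_def)
  then show ?thesis
    using Ac by (simp add: esd_integral_def interv_sum_list_conv_sum_set_nat atLeast0LessThan)
qed

lemma index_mult_mat_sum:
  assumes "A \<in> carrier_mat n m" "B \<in> carrier_mat m k" "i < n" "j < k"
  shows "(A * B) $$ (i, j) = (\<Sum>r<m. A $$ (i, r) * B $$ (r, j))"
  using assms by (auto simp: scalar_prod_def atLeast0LessThan)

lemma unitary_diag_entry:
  assumes "unitary_diag n A P l" "i < n" "j < n"
  shows "A $$ (i, j) = (\<Sum>k<n. P $$ (i, k) * of_real (l k) * cnj (P $$ (j, k)))"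
proof -
  have P: "P \<in> carrier_mat n n" and A: "A = P * rdiag n l * cadj P"
    using assms by (auto simp: unitary_diag_def)
  have PD: "(P * rdiag n l) $$ (i, k) = P $$ (i, k) * of_real (l k)" if "k < n" for k
  proof -
    have "(P * rdiag n l) $$ (i, k) = (\<Sum>r<n. P $$ (i, r) * rdiag n l $$ (r, k))"
      using P that assms(2) by (subst index_mult_mat) (auto simp: scalar_prod_def atLeast0LessThan rdiag_def)
    also have "\<dots> = (\<Sum>r<n. if r = k then P $$ (i, k) * of_real (l k) else 0)"
      using that by (intro sum.cong) (auto simp: rdiag_def)
    finally show ?thesis using that by simp
  qed
  have "A $$ (i, j) = (\<Sum>k<n. (P * rdiag n l) $$ (i, k) * cadj P $$ (k, j))"
    unfolding A
    by (rule index_mult_mat_sum[OF mult_carrier_mat[OF P rdiag_carrier] cadj_carrier[OF P] assms(2,3)])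
  also have "\<dots> = (\<Sum>k<n. P $$ (i, k) * of_real (l k) * cnj (P $$ (j, k)))"
    using P assms(3) by (intro sum.cong) (auto simp: PD)
  finally show ?thesis .
qed

text \<open>Applied to a unitary matrix and to its adjoint, this makes the matrix of squared moduli
  of the entries doubly stochastic.\<close>

lemma unitary_col_norm:
  assumes W: "W \<in> carrier_mat n n" and WW: "cadj W * W = 1\<^sub>m n" and r: "r < n"
  shows "(\<Sum>k<n. (cmod (W $$ (k, r)))\<^sup>2) = 1"
proof -
  have "(cadj W * W) $$ (r, r) = (\<Sum>k<n. cadj W $$ (r, k) * W $$ (k, r))"
    using W r by (subst index_mult_mat) (auto simp: scalar_prod_def atLeast0LessThan)
  also have "\<dots> = (\<Sum>k<n. of_real ((cmod (W $$ (k, r)))\<^sup>2))"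
    using W r by (intro sum.cong) (auto simp: complex_norm_square mult.commute simp del: of_real_power)
  also have "\<dots> = of_real (\<Sum>k<n. (cmod (W $$ (k, r)))\<^sup>2)" by simp
  finally show ?thesis using r unfolding WW by (simp add: of_real_eq_1_iff del: of_real_sum of_real_power)
qed

text \<open>The trace of a product of two spectral expansions with vectors in the columns of
  \<open>p\<close> and \<open>q\<close>. Reordering the four sums separates the overlap of
  \<open>p\<close>-column \<open>k\<close> and \<open>q\<close>-column \<open>r\<close> (sum over
  \<open>i\<close>) from its conjugate (sum over \<open>j\<close>).\<close>

lemma trace_prod_overlap:
  fixes p q :: "nat \<Rightarrow> nat \<Rightarrow> complex"
  shows "(\<Sum>i<n. \<Sum>j<n. (\<Sum>k<n. p j k * of_real (s k) * cnj (p i k)) * (\<Sum>r<n. q i r * of_real (m r) * cnj (q j r)))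
    = of_real (\<Sum>k<n. \<Sum>r<n. s k * m r * (cmod (\<Sum>i<n. cnj (p i k) * q i r))\<^sup>2)"
proof -
  let ?g = "\<lambda>k r i j. of_real (s k * m r) * ((cnj (p i k) * q i r) * (p j k * cnj (q j r)))"
  have "(\<Sum>i<n. \<Sum>j<n. (\<Sum>k<n. p j k * of_real (s k) * cnj (p i k)) * (\<Sum>r<n. q i r * of_real (m r) * cnj (q j r)))
    = (\<Sum>i<n. \<Sum>j<n. \<Sum>k<n. \<Sum>r<n. ?g k r i j)"
    unfolding sum_product by (intro sum.cong refl) (simp add: mult_ac)
  also have "\<dots> = (\<Sum>i<n. \<Sum>k<n. \<Sum>j<n. \<Sum>r<n. ?g k r i j)"
    by (intro sum.cong refl sum.swap)
  also have "\<dots> = (\<Sum>i<n. \<Sum>k<n. \<Sum>r<n. \<Sum>j<n. ?g k r i j)"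
    by (intro sum.cong refl sum.swap)
  also have "\<dots> = (\<Sum>k<n. \<Sum>i<n. \<Sum>r<n. \<Sum>j<n. ?g k r i j)"
    by (rule sum.swap)
  also have "\<dots> = (\<Sum>k<n. \<Sum>r<n. \<Sum>i<n. \<Sum>j<n. ?g k r i j)"
    by (intro sum.cong refl sum.swap)
  also have "\<dots> = (\<Sum>k<n. \<Sum>r<n. of_real (s k * m r) *
      ((\<Sum>i<n. cnj (p i k) * q i r) * cnj (\<Sum>i<n. cnj (p i k) * q i r)))"
    unfolding sum_product cnj_sum by (simp add: sum_distrib_left)
  also have "\<dots> = of_real (\<Sum>k<n. \<Sum>r<n. s k * m r * (cmod (\<Sum>i<n. cnj (p i k) * q i r))\<^sup>2)"
    by (simp add: complex_norm_square del: of_real_power)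
  finally show ?thesis .
qed

text \<open>The matrix \<open>S\<close> is \<open>sgn (A - t)\<close>; it maximises \<open>Re tr (S (A - t))\<close> over
  Hermitian contractions, so it is a subgradient of \<open>B \<mapsto> tr \<bar>B - t\<bar>\<close> at \<open>A\<close>.\<close>
lemma esd_abs_subgradient:
  assumes "hermitian_mat n A"
  obtains S :: "nat \<Rightarrow> nat \<Rightarrow> complex"
  where "\<And>i j. S j i = cnj (S i j)"
    and "(\<Sum>i<n. \<Sum>j<n. (cmod (S i j))\<^sup>2) \<le> real n"
    and "\<And>B. hermitian_mat n B \<Longrightarrow>
      real n * (esd_integral (\<lambda>z. \<bar>z - t\<bar>) A - esd_integral (\<lambda>z. \<bar>z - t\<bar>) B)
        \<le> Re (\<Sum>i<n. \<Sum>j<n. S j i * (A $$ (i, j) - B $$ (i, j)))"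
proof -
  obtain P l where ud: "unitary_diag n A P l"
    using hermitian_spectral[OF assms] unfolding unitary_diag_def by metis
  then have P: "P \<in> carrier_mat n n" and PP: "cadj P * P = 1\<^sub>m n"
    by (auto simp: unitary_diag_def)
  have cP: "cadj P \<in> carrier_mat n n" using P by simp
  have PP': "P * cadj P = 1\<^sub>m n" by (rule mat_mult_left_right_inverse[OF cP P PP])
  \<comment> \<open>The value is \<open>0\<close> at \<open>l k = t\<close>; in all cases
    \<open>\<bar>s k\<bar> \<le> 1\<close> and
    \<open>s k * (l k - t) = \<bar>l k - t\<bar>\<close>.\<close>
  define s where "s k = sgn (l k - t)" for k
  define S where "S i j = (\<Sum>k<n. P $$ (i, k) * of_real (s k) * cnj (P $$ (j, k)))" for i j
  have w: "(\<Sum>i<n. cnj (P $$ (i, k)) * Q $$ (i, r)) = (cadj P * Q) $$ (k, r)"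
    if "Q \<in> carrier_mat n n" "k < n" "r < n" for Q k r
    using that P by (subst index_mult_mat) (auto simp: scalar_prod_def atLeast0LessThan)
  \<comment> \<open>The overlaps of the orthonormal columns of \<open>P\<close> with themselves form
    the identity matrix.\<close>
  have self: "(\<Sum>k<n. \<Sum>r<n. s k * m r * (cmod (\<Sum>i<n. cnj (P $$ (i, k)) * P $$ (i, r)))\<^sup>2) = (\<Sum>k<n. s k * m k)"
    for m :: "nat \<Rightarrow> real"
  proof -
    have "(\<Sum>k<n. \<Sum>r<n. s k * m r * (cmod (\<Sum>i<n. cnj (P $$ (i, k)) * P $$ (i, r)))\<^sup>2)
        = (\<Sum>k<n. \<Sum>r<n. if r = k then s k * m k else 0)"
      by (intro sum.cong refl) (auto simp: w[OF P] PP)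
    then show ?thesis by simp
  qed
  show thesis
  proof (rule that[of S])
    show sym: "S j i = cnj (S i j)" for i j
      by (simp add: S_def mult_ac)
    have "(\<Sum>i<n. \<Sum>j<n. of_real ((cmod (S i j))\<^sup>2)) = (\<Sum>i<n. \<Sum>j<n. S j i * S i j)"
      by (intro sum.cong refl, subst sym) (simp add: complex_norm_square mult.commute del: of_real_power)
    also have "\<dots> = of_real (\<Sum>k<n. s k * s k)"
      unfolding S_def trace_prod_overlap self ..
    finally have "(\<Sum>i<n. \<Sum>j<n. (cmod (S i j))\<^sup>2) = (\<Sum>k<n. s k * s k)"
      by (simp only: of_real_sum[symmetric] of_real_eq_iff)
    also have "\<dots> \<le> (\<Sum>k<n. 1)" by (intro sum_mono) (auto simp: s_def sgn_if)
    finally show "(\<Sum>i<n. \<Sum>j<n. (cmod (S i j))\<^sup>2) \<le> real n" by simp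
    fix B assume "hermitian_mat n B"
    then obtain Q m where ud': "unitary_diag n B Q m"
      using hermitian_spectral unfolding unitary_diag_def by metis
    then have Q: "Q \<in> carrier_mat n n" and QQ: "cadj Q * Q = 1\<^sub>m n"
      by (auto simp: unitary_diag_def)
    have cQ: "cadj Q \<in> carrier_mat n n" using Q by simp
    define W where "W = cadj P * Q"
    have W: "W \<in> carrier_mat n n" unfolding W_def by (rule mult_carrier_mat[OF cP Q])
    have WW: "cadj W * W = 1\<^sub>m n"
      unfolding W_def by (rule unitary_mult[OF cP Q _ QQ]) (simp add: PP')
    have cW: "cadj W \<in> carrier_mat n n" using W by simp
    have WW': "cadj (cadj W) * cadj W = 1\<^sub>m n"
      using mat_mult_left_right_inverse[OF cW W WW] by simp
    \<comment> \<open>\<open>W\<close> is the unitary change of basis between the eigenbases of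
      \<open>A\<close> and \<open>B\<close>, so \<open>c\<close> is doubly stochastic.\<close>
    define c where "c k r = (cmod (W $$ (k, r)))\<^sup>2" for k r
    have c0: "0 \<le> c k r" for k r by (simp add: c_def)
    have c_col: "(\<Sum>k<n. c k r) = 1" if "r < n" for r
      unfolding c_def by (rule unitary_col_norm[OF W WW that])
    have c_row: "(\<Sum>r<n. c k r) = 1" if "k < n" for k
    proof -
      have "(\<Sum>r<n. c k r) = (\<Sum>r<n. (cmod (cadj W $$ (r, k)))\<^sup>2)"
        using W that by (intro sum.cong) (auto simp: c_def)
      then show ?thesis using unitary_col_norm[OF cW WW' that] by simp
    qed
    have trA: "(\<Sum>i<n. \<Sum>j<n. S j i * A $$ (i, j)) = of_real (\<Sum>k<n. s k * l k)"
      unfolding self[symmetric] trace_prod_overlap[symmetric] S_def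
      by (intro sum.cong refl) (simp add: unitary_diag_entry[OF ud])
    have "(\<Sum>i<n. \<Sum>j<n. S j i * B $$ (i, j)) =
        of_real (\<Sum>k<n. \<Sum>r<n. s k * m r * (cmod (\<Sum>i<n. cnj (P $$ (i, k)) * Q $$ (i, r)))\<^sup>2)"
      unfolding trace_prod_overlap[symmetric] S_def
      by (intro sum.cong refl) (simp add: unitary_diag_entry[OF ud'])
    also have "\<dots> = of_real (\<Sum>k<n. \<Sum>r<n. s k * m r * c k r)"
      by (intro arg_cong[where f = of_real] sum.cong refl) (simp add: w[OF Q] c_def W_def)
    finally have trB: "(\<Sum>i<n. \<Sum>j<n. S j i * B $$ (i, j)) = of_real (\<Sum>k<n. \<Sum>r<n. s k * m r * c k r)" .
    \<comment> \<open>Unit row sums of \<open>c\<close> spread the shift by \<open>t\<close> over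
      both indices; then \<open>\<bar>s k\<bar> \<le> 1\<close> and unit column sums leave the sum
      of the \<open>\<bar>m r - t\<bar>\<close>.\<close>
    have "(\<Sum>k<n. \<Sum>r<n. s k * m r * c k r) - (\<Sum>k<n. s k * t) = (\<Sum>k<n. \<Sum>r<n. s k * (m r - t) * c k r)"
    proof -
      have "(\<Sum>k<n. s k * t) = (\<Sum>k<n. \<Sum>r<n. s k * t * c k r)"
        by (intro sum.cong refl) (simp add: sum_distrib_left[symmetric] c_row)
      then show ?thesis by (simp add: sum_subtractf[symmetric] algebra_simps)
    qed
    also have "\<dots> = (\<Sum>r<n. \<Sum>k<n. s k * (m r - t) * c k r)" by (rule sum.swap)
    also have "\<dots> \<le> (\<Sum>r<n. \<Sum>k<n. \<bar>m r - t\<bar> * c k r)"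
      by (intro sum_mono mult_right_mono c0) (auto simp: s_def sgn_if)
    also have "\<dots> = (\<Sum>r<n. \<bar>m r - t\<bar>)"
      by (intro sum.cong refl) (simp add: sum_distrib_left[symmetric] c_col)
    finally have 1: "(\<Sum>k<n. \<Sum>r<n. s k * m r * c k r) - (\<Sum>k<n. s k * t) \<le> (\<Sum>r<n. \<bar>m r - t\<bar>)" .
    have 2: "(\<Sum>k<n. \<bar>l k - t\<bar>) = (\<Sum>k<n. s k * l k) - (\<Sum>k<n. s k * t)"
      unfolding sum_subtractf[symmetric] by (intro sum.cong refl) (auto simp: s_def sgn_if algebra_simps)
    have "real n * (esd_integral (\<lambda>z. \<bar>z - t\<bar>) A - esd_integral (\<lambda>z. \<bar>z - t\<bar>) B)
        = (\<Sum>k<n. \<bar>l k - t\<bar>) - (\<Sum>r<n. \<bar>m r - t\<bar>)"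
      unfolding esd_integral_unitary_diag[OF ud] esd_integral_unitary_diag[OF ud']
      by (cases "n = 0") (simp_all add: field_simps)
    also have "\<dots> \<le> (\<Sum>k<n. s k * l k) - (\<Sum>k<n. \<Sum>r<n. s k * m r * c k r)"
      using 1 2 by linarith
    also have "\<dots> = Re (\<Sum>i<n. \<Sum>j<n. S j i * (A $$ (i, j) - B $$ (i, j)))"
      unfolding right_diff_distrib sum_subtractf trA trB by simp
    finally show "real n * (esd_integral (\<lambda>z. \<bar>z - t\<bar>) A - esd_integral (\<lambda>z. \<bar>z - t\<bar>) B)
        \<le> Re (\<Sum>i<n. \<Sum>j<n. S j i * (A $$ (i, j) - B $$ (i, j)))" .
  qed
qed

section \<open>The absolute value statistic on arbitrary complex arrays\<close>

definition hpart :: "nat \<Rightarrow> (nat \<times> nat \<Rightarrow> complex) \<Rightarrow> complex mat" where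
  "hpart n x = mat n n (\<lambda>(i, j). (x (i, j) + cnj (x (j, i))) / 2)"

definition abs_stat :: "nat \<Rightarrow> real \<Rightarrow> (nat \<times> nat \<Rightarrow> complex) \<Rightarrow> real" where
  "abs_stat n t x = esd_integral (\<lambda>z. \<bar>z - t\<bar>) ((1 / sqrt (real n)) \<cdot>\<^sub>m hpart n x)"

lemma hermitian_hpart: "hermitian_mat n (hpart n x)"
  by (auto simp: hermitian_mat_def hpart_def)

lemma hermitian_smult:
  assumes "hermitian_mat n A"
  shows "hermitian_mat n (of_real c \<cdot>\<^sub>m A)"
  unfolding hermitian_mat_def
proof (intro conjI allI impI)
  have A: "A \<in> carrier_mat n n" using assms by (simp add: hermitian_mat_def)
  then show "of_real c \<cdot>\<^sub>m A \<in> carrier_mat n n" by simp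
  fix i j assume ij: "i < n" "j < n"
  with assms have "cnj (A $$ (i, j)) = A $$ (j, i)" unfolding hermitian_mat_def by metis
  with ij A show "(of_real c \<cdot>\<^sub>m A) $$ (j, i) = cnj ((of_real c \<cdot>\<^sub>m A) $$ (i, j))"
    by simp
qed

lemma hpart_hermitian:
  assumes "hermitian_mat n A"
  shows "hpart n (\<lambda>p. A $$ p) = A"
proof (rule eq_matI)
  fix i j assume "i < dim_row A" "j < dim_col A"
  then have "i < n" "j < n" using assms by (auto simp: hermitian_mat_def)
  with assms have "cnj (A $$ (j, i)) = A $$ (i, j)" unfolding hermitian_mat_def by metis
  with \<open>i < n\<close> \<open>j < n\<close> show "hpart n (\<lambda>p. A $$ p) $$ (i, j) = A $$ (i, j)" by (simp add: hpart_def)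
qed (use assms in \<open>auto simp: hpart_def hermitian_mat_def\<close>)

text \<open>Since \<open>S\<close> is Hermitian, the conjugate transpose of \<open>z\<close>
  contributes the conjugate of the sum for \<open>z\<close>, so taking Hermitian parts does not
  change the real part of the pairing.\<close>

lemma Re_sum_hpart:
  fixes S :: "nat \<Rightarrow> nat \<Rightarrow> complex"
  assumes S: "\<And>i j. S j i = cnj (S i j)"
  shows "Re (\<Sum>i<n. \<Sum>j<n. S j i * ((z i j + cnj (z j i)) / 2)) = Re (\<Sum>i<n. \<Sum>j<n. S j i * z i j)"
proof -
  have "(\<Sum>i<n. \<Sum>j<n. S j i * cnj (z j i)) = (\<Sum>j<n. \<Sum>i<n. S j i * cnj (z j i))"
    by (rule sum.swap)
  also have "\<dots> = cnj (\<Sum>i<n. \<Sum>j<n. S j i * z i j)"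
    unfolding cnj_sum complex_cnj_mult S[symmetric] ..
  finally have *: "(\<Sum>i<n. \<Sum>j<n. S j i * cnj (z j i)) = cnj (\<Sum>i<n. \<Sum>j<n. S j i * z i j)" .
  have "(\<Sum>i<n. \<Sum>j<n. S j i * ((z i j + cnj (z j i)) / 2))
      = ((\<Sum>i<n. \<Sum>j<n. S j i * z i j) + (\<Sum>i<n. \<Sum>j<n. S j i * cnj (z j i))) / 2"
    unfolding sum.distrib[symmetric] sum_divide_distrib by (intro sum.cong refl) (simp add: field_simps)
  moreover have "Re ((w + cnj w) / 2) = Re w" for w by simp
  ultimately show ?thesis by (simp only: *)
qed

text \<open>The matrix \<open>S\<close> has Frobenius norm at most \<open>sqrt n\<close>; the
  average over eigenvalues contributes a factor \<open>1 / n\<close> and the scaling of the matrix a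
  factor \<open>1 / sqrt n\<close>, leaving norm at most \<open>1 / n\<close>. The weights
  \<open>u\<close> depend on \<open>x\<close> alone and serve all \<open>y\<close> at once.\<close>

lemma abs_stat_subgradient:
  assumes n: "n > 0"
  obtains u :: "nat \<times> nat \<Rightarrow> real"
  where "\<And>p. 0 \<le> u p" "(\<Sum>p\<in>{..<n} \<times> {..<n}. (u p)\<^sup>2) \<le> 1 / (real n)\<^sup>2"
    "\<And>y. abs_stat n t x - abs_stat n t y \<le> (\<Sum>p\<in>{..<n} \<times> {..<n}. u p * cmod (x p - y p))"
proof -
  let ?c = "1 / sqrt (real n)"
  let ?A = "\<lambda>x. of_real ?c \<cdot>\<^sub>m hpart n x"
  have H: "hermitian_mat n (?A x)" for x by (intro hermitian_smult hermitian_hpart)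
  have stat: "abs_stat n t x = esd_integral (\<lambda>z. \<bar>z - t\<bar>) (?A x)" for x
    by (simp add: abs_stat_def)
  obtain S :: "nat \<Rightarrow> nat \<Rightarrow> complex" where S: "\<And>i j. S j i = cnj (S i j)"
    and S2: "(\<Sum>i<n. \<Sum>j<n. (cmod (S i j))\<^sup>2) \<le> real n"
    and le: "\<And>B. hermitian_mat n B \<Longrightarrow>
      real n * (esd_integral (\<lambda>z. \<bar>z - t\<bar>) (?A x) - esd_integral (\<lambda>z. \<bar>z - t\<bar>) B)
        \<le> Re (\<Sum>i<n. \<Sum>j<n. S j i * (?A x $$ (i, j) - B $$ (i, j)))"
    using esd_abs_subgradient[OF H] by blast
  define u where "u p = ?c / real n * cmod (S (fst p) (snd p))" for p
  have Sc: "cmod (S j i) = cmod (S i j)" for i j by (subst S) simp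
  show thesis
  proof (rule that[of u])
    show "0 \<le> u p" for p by (simp add: u_def)
    have "(\<Sum>p\<in>{..<n} \<times> {..<n}. (u p)\<^sup>2) = (?c / real n)\<^sup>2 * (\<Sum>i<n. \<Sum>j<n. (cmod (S i j))\<^sup>2)"
      unfolding u_def power_mult_distrib sum_distrib_left[symmetric]
      by (simp add: sum.cartesian_product case_prod_unfold)
    also have "\<dots> \<le> (?c / real n)\<^sup>2 * real n" by (intro mult_left_mono S2) simp
    also have "\<dots> = 1 / (real n)\<^sup>2" using n by (simp add: power_divide field_simps)
    finally show "(\<Sum>p\<in>{..<n} \<times> {..<n}. (u p)\<^sup>2) \<le> 1 / (real n)\<^sup>2" .
    fix y
    have "real n * (abs_stat n t x - abs_stat n t y) \<le>
        Re (\<Sum>i<n. \<Sum>j<n. S j i * (?A x $$ (i, j) - ?A y $$ (i, j)))"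
      unfolding stat by (rule le[OF H])
    also have "(\<Sum>i<n. \<Sum>j<n. S j i * (?A x $$ (i, j) - ?A y $$ (i, j)))
        = of_real ?c * (\<Sum>i<n. \<Sum>j<n. S j i * (((x (i, j) - y (i, j)) + cnj (x (j, i) - y (j, i))) / 2))"
      unfolding sum_distrib_left by (intro sum.cong refl) (simp add: hpart_def field_simps)
    also have "Re \<dots> = ?c * Re (\<Sum>i<n. \<Sum>j<n. S j i * (x (i, j) - y (i, j)))"
      using Re_sum_hpart[OF S, where n = n and z = "\<lambda>i j. x (i, j) - y (i, j)"]
      by (simp only: Re_complex_of_real Im_complex_of_real times_complex.sel)
    also have "\<dots> \<le> ?c * (\<Sum>i<n. \<Sum>j<n. cmod (S i j) * cmod (x (i, j) - y (i, j)))"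
    proof (intro mult_left_mono)
      have "Re (\<Sum>i<n. \<Sum>j<n. S j i * (x (i, j) - y (i, j))) \<le> cmod (\<Sum>i<n. \<Sum>j<n. S j i * (x (i, j) - y (i, j)))"
        by (rule complex_Re_le_cmod)
      also have "\<dots> \<le> (\<Sum>i<n. \<Sum>j<n. cmod (S j i * (x (i, j) - y (i, j))))"
        by (intro order.trans[OF norm_sum] sum_mono order.refl)
      finally show "Re (\<Sum>i<n. \<Sum>j<n. S j i * (x (i, j) - y (i, j))) \<le> (\<Sum>i<n. \<Sum>j<n. cmod (S i j) * cmod (x (i, j) - y (i, j)))"
        by (simp add: norm_mult Sc)
    qed simp
    also have "\<dots> = real n * (\<Sum>p\<in>{..<n} \<times> {..<n}. u p * cmod (x p - y p))"
      unfolding u_def sum_distrib_left sum.cartesian_product using n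
      by (intro sum.cong) (auto simp: field_simps)
    finally show "abs_stat n t x - abs_stat n t y \<le> (\<Sum>p\<in>{..<n} \<times> {..<n}. u p * cmod (x p - y p))"
      using n by simp
  qed
qed

text \<open>Cauchy-Schwarz applied to the subgradient inequality at \<open>x\<close>, and at
  \<open>y\<close> for the other sign.\<close>

lemma abs_stat_lipschitz:
  assumes "n > 0"
  shows "\<bar>abs_stat n t x - abs_stat n t y\<bar> \<le> sqrt (\<Sum>p\<in>{..<n} \<times> {..<n}. (cmod (x p - y p))\<^sup>2) / real n"
proof -
  have *: "abs_stat n t x - abs_stat n t y \<le> sqrt (\<Sum>p\<in>{..<n} \<times> {..<n}. (cmod (x p - y p))\<^sup>2) / real n" for x y
  proof -
    obtain u where u: "\<And>p. 0 \<le> u p" "(\<Sum>p\<in>{..<n} \<times> {..<n}. (u p)\<^sup>2) \<le> 1 / (real n)\<^sup>2"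
      "\<And>y. abs_stat n t x - abs_stat n t y \<le> (\<Sum>p\<in>{..<n} \<times> {..<n}. u p * cmod (x p - y p))"
      using abs_stat_subgradient[OF assms, of t x] by blast
    note u(3)[of y]
    also have "(\<Sum>p\<in>{..<n} \<times> {..<n}. u p * cmod (x p - y p))
        \<le> L2_set u ({..<n} \<times> {..<n}) * L2_set (\<lambda>p. cmod (x p - y p)) ({..<n} \<times> {..<n})"
      using L2_set_mult_ineq[of u "\<lambda>p. cmod (x p - y p)" "{..<n} \<times> {..<n}"] u(1) by simp
    also have "\<dots> \<le> (1 / real n) * L2_set (\<lambda>p. cmod (x p - y p)) ({..<n} \<times> {..<n})"
    proof (intro mult_right_mono)
      have "L2_set u ({..<n} \<times> {..<n}) \<le> sqrt (1 / (real n)\<^sup>2)"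
        unfolding L2_set_def by (rule real_sqrt_le_mono[OF u(2)])
      then show "L2_set u ({..<n} \<times> {..<n}) \<le> 1 / real n" by (simp add: real_sqrt_divide)
    qed simp
    finally show ?thesis by (simp add: L2_set_def)
  qed
  show ?thesis using *[of x y] *[of y x] by (simp add: abs_le_iff norm_minus_commute)
qed

text \<open>The Lipschitz bound involves finitely many coordinates, so the statistic is continuous
  for the product topology; over a countable index set the product sigma-algebra is the Borel
  one.\<close>

lemma abs_stat_measurable [measurable]:
  assumes "n > 0"
  shows "abs_stat n t \<in> borel_measurable (\<Pi>\<^sub>M p\<in>UNIV. borel)"
proof -
  have "(abs_stat n t \<longlongrightarrow> abs_stat n t x) (at x)" for x
  proof -
    have "continuous_on UNIV (\<lambda>y :: nat \<times> nat \<Rightarrow> complex. y p)" for p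
      by (rule continuous_on_product_coordinates)
    then have coord: "((\<lambda>y :: nat \<times> nat \<Rightarrow> complex. y p) \<longlongrightarrow> x p) (at x)" for p
      by (simp add: continuous_on_def)
    have "((\<lambda>y. sqrt (\<Sum>p\<in>{..<n} \<times> {..<n}. (cmod (y p - x p))\<^sup>2) / real n) \<longlongrightarrow>
        sqrt (\<Sum>p\<in>{..<n} \<times> {..<n}. (cmod (x p - x p))\<^sup>2) / real n) (at x)"
      by (intro tendsto_intros coord) (use assms in simp)
    then have "((\<lambda>y. sqrt (\<Sum>p\<in>{..<n} \<times> {..<n}. (cmod (y p - x p))\<^sup>2) / real n) \<longlongrightarrow> 0) (at x)"
      by simp
    then have "((\<lambda>y. abs_stat n t y - abs_stat n t x) \<longlongrightarrow> 0) (at x)"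
      by (rule Lim_null_comparison[rotated]) (auto intro!: always_eventually abs_stat_lipschitz[OF assms])
    then show ?thesis by (rule LIM_zero_cancel)
  qed
  then have "continuous_on UNIV (abs_stat n t)"
    by (simp add: continuous_on_def)
  then have "abs_stat n t \<in> borel_measurable borel"
    by (rule borel_measurable_continuous_onI)
  then show ?thesis
    using measurable_cong_sets[OF sets_PiM_equal_borel[where 'a = "nat \<times> nat" and 'b = complex] refl] by blast
qed

subsection \<open>A one-sided Efron--Stein inequality\<close>

lemma indep_vars_PiM_coordinates:
  assumes "\<And>i. i \<in> I \<Longrightarrow> prob_space (\<mu> i)" "I \<noteq> {}"
  shows "prob_space.indep_vars (Pi\<^sub>M I \<mu>) \<mu> (\<lambda>i \<omega>. \<omega> i) I"
proof -
  interpret P: prob_space "Pi\<^sub>M I \<mu>" by (rule prob_space_PiM) fact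
  have "distr (Pi\<^sub>M I \<mu>) (Pi\<^sub>M I \<mu>) (\<lambda>\<omega>. \<lambda>i\<in>I. \<omega> i) = Pi\<^sub>M I \<mu>"
    using distr_PiM_reindex[of I \<mu> "\<lambda>i. i" I] assms by simp
  also have "\<dots> = (\<Pi>\<^sub>M i\<in>I. distr (Pi\<^sub>M I \<mu>) (\<mu> i) (\<lambda>\<omega>. \<omega> i))"
    by (intro PiM_cong refl distr_PiM_component[symmetric] assms)
  finally show ?thesis
    by (subst P.indep_vars_iff_distr_eq_PiM'[OF assms(2)]) auto
qed

text \<open>Only the positive parts of the resampling differences occur on the right, which is what
  makes a subgradient bound at the single point \<open>x\<close> sufficient. With \<open>X'\<close> an independent copy of
  \<open>X\<close>, the proof telescopes \<open>Cov (g X) (g X - g X')\<close> over the coordinates replaced one at a time and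
  symmetrises each term by the measure preserving exchange of \<open>X\<^sub>k\<close> and \<open>X'\<^sub>k\<close>: here \<open>mix T\<close>
  takes the coordinates in \<open>T\<close> from the copy, and \<open>flip T\<close> exchanges them.\<close>
lemma efron_stein_PiM:
  fixes g :: "('i \<Rightarrow> 'b) \<Rightarrow> real"
  assumes I: "finite I" "I \<noteq> {}" and \<mu>: "\<And>i. prob_space (\<mu> i)"
    and g [measurable]: "g \<in> borel_measurable (Pi\<^sub>M I \<mu>)"
    and bdd: "\<And>x. x \<in> space (Pi\<^sub>M I \<mu>) \<Longrightarrow> \<bar>g x\<bar> \<le> C"
    and K: "\<And>x y. x \<in> space (Pi\<^sub>M I \<mu>) \<Longrightarrow> y \<in> space (Pi\<^sub>M I \<mu>) \<Longrightarrow>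
      (\<Sum>i\<in>I. (max 0 (g x - g (x(i := y i))))\<^sup>2) \<le> K"
  shows "(\<integral>x. (g x - integral\<^sup>L (Pi\<^sub>M I \<mu>) g)\<^sup>2 \<partial>Pi\<^sub>M I \<mu>) \<le> K"
proof -
  \<comment> \<open>Both samples live on one product space: the tag \<open>False\<close> marks the
    original coordinates and \<open>True\<close> the independent copy.\<close>
  let ?J = "I \<times> (UNIV :: bool set)"
  define \<nu> where "\<nu> = (\<lambda>p :: 'i \<times> bool. \<mu> (fst p))"
  define N where "N = Pi\<^sub>M ?J \<nu>"
  define mix where "mix T \<omega> = (\<lambda>i\<in>I. \<omega> (i, i \<in> T))" for T and \<omega> :: "'i \<times> bool \<Rightarrow> 'b"
  define flip where "flip T \<omega> = (\<lambda>p\<in>?J. \<omega> (fst p, snd p \<noteq> (fst p \<in> T)))" for T and \<omega> :: "'i \<times> bool \<Rightarrow> 'b"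
  interpret P: product_prob_space \<mu> I
    by (intro product_prob_spaceI \<mu>)
  interpret J: product_prob_space \<nu> ?J
    by (intro product_prob_spaceI) (simp add: \<nu>_def \<mu>)
  interpret N: prob_space N
    unfolding N_def by (rule J.prob_space_axioms)
  \<comment> \<open>Selecting one of the two equally distributed copies for each \<open>i\<close> is
    an injective reindexing, so every \<open>mix T\<close> has the original law.\<close>
  have mix_distr: "distr N (Pi\<^sub>M I \<mu>) (mix T) = Pi\<^sub>M I \<mu>" for T
    using distr_PiM_reindex[of ?J \<nu> "\<lambda>i. (i, i \<in> T)" I]
    by (simp add: \<nu>_def \<mu> N_def mix_def[abs_def] inj_on_def)
  have mix_meas [measurable]: "mix T \<in> N \<rightarrow>\<^sub>M Pi\<^sub>M I \<mu>" for T
  proof -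
    have "(\<lambda>\<omega>. \<omega> (i, i \<in> T)) \<in> N \<rightarrow>\<^sub>M \<mu> i" if "i \<in> I" for i
      using measurable_component_singleton[of "(i, i \<in> T)" ?J \<nu>] that by (simp add: N_def \<nu>_def)
    then show ?thesis unfolding mix_def[abs_def] by (intro measurable_restrict)
  qed
  have flip_distr: "distr N N (flip T) = N" for T
  proof -
    let ?f = "\<lambda>p. (fst p, snd p \<noteq> (fst p \<in> T))"
    have "inj_on ?f ?J" "?f \<in> ?J \<rightarrow> ?J" by (auto simp: inj_on_def)
    moreover have "\<nu> (?f p) = \<nu> p" for p by (simp add: \<nu>_def)
    ultimately show ?thesis
      using distr_PiM_reindex[of ?J \<nu> ?f ?J] unfolding N_def flip_def[abs_def] by (simp add: \<nu>_def \<mu>)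
  qed
  have flip_meas [measurable]: "flip T \<in> N \<rightarrow>\<^sub>M N" for T
  proof -
    have "(\<lambda>\<omega>. \<omega> (fst p, snd p \<noteq> (fst p \<in> T))) \<in> N \<rightarrow>\<^sub>M \<nu> p" if "p \<in> ?J" for p
      using measurable_component_singleton[of "(fst p, snd p \<noteq> (fst p \<in> T))" ?J \<nu>] that
      by (auto simp: N_def \<nu>_def)
    then show ?thesis unfolding flip_def[abs_def] N_def[symmetric]
      by (subst (2) N_def, intro measurable_restrict)
  qed
  \<comment> \<open>Exchanging the copies on \<open>T\<close> acts on the selecting set by symmetric
    difference; together with the invariance of \<open>N\<close> this yields every exchange identity
    below.\<close>
  have mix_flip: "mix U (flip T \<omega>) = mix (sym_diff U T) \<omega>" for U T \<omega>
    by (auto simp: mix_def flip_def fun_eq_iff intro!: arg_cong[where f = \<omega>])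
  have int_flip: "(\<integral>\<omega>. h (flip T \<omega>) \<partial>N) = integral\<^sup>L N h" if "h \<in> borel_measurable N"
    for T and h :: "_ \<Rightarrow> real"
    using integral_distr[OF flip_meas that, of T] by (simp add: flip_distr)
  define e where "e T \<omega> = g (mix T \<omega>)" for T \<omega>
  have e_meas [measurable]: "e T \<in> borel_measurable N" for T
    unfolding e_def by measurable
  have e_bdd: "\<bar>e T \<omega>\<bar> \<le> C" if "\<omega> \<in> space N" for T \<omega>
    unfolding e_def by (rule bdd) (rule measurable_space[OF mix_meas that])
  have e_flip: "e U (flip T \<omega>) = e (sym_diff U T) \<omega>" for U T \<omega>
    by (simp add: e_def mix_flip)
  have C0: "0 \<le> C" using e_bdd N.not_empty by (metis abs_ge_zero ex_in_conv order_trans)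
  have int1: "integrable N (\<lambda>\<omega>. (e A \<omega> - e B \<omega>) * (e A' \<omega> - e B' \<omega>))" for A B A' B'
  proof (rule N.integrable_const_bound[of _ "(2 * C) * (2 * C)"])
    show "AE \<omega> in N. norm ((e A \<omega> - e B \<omega>) * (e A' \<omega> - e B' \<omega>)) \<le> 2 * C * (2 * C)"
    proof (intro AE_I2)
      fix \<omega> assume "\<omega> \<in> space N"
      note b = e_bdd[OF this]
      have "\<bar>e A \<omega> - e B \<omega>\<bar> \<le> 2 * C" "\<bar>e A' \<omega> - e B' \<omega>\<bar> \<le> 2 * C"
        using b[of A] b[of B] b[of A'] b[of B'] by linarith+
      then show "norm ((e A \<omega> - e B \<omega>) * (e A' \<omega> - e B' \<omega>)) \<le> 2 * C * (2 * C)"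
        unfolding real_norm_def abs_mult using C0 by (intro mult_mono) auto
    qed
  qed measurable
  have int2: "integrable N (\<lambda>\<omega>. e A \<omega> * e B \<omega>)" for A B
  proof (rule N.integrable_const_bound[of _ "C * C"])
    show "AE \<omega> in N. norm (e A \<omega> * e B \<omega>) \<le> C * C"
      unfolding real_norm_def abs_mult using C0 by (intro AE_I2 mult_mono e_bdd) auto
  qed measurable
  have int3: "integrable N (\<lambda>\<omega>. (max 0 (e A \<omega> - e B \<omega>))\<^sup>2)" for A B
  proof (rule Bochner_Integration.integrable_bound[OF int1[of A B A B]])
    show "AE \<omega> in N. norm ((max 0 (e A \<omega> - e B \<omega>))\<^sup>2) \<le> norm ((e A \<omega> - e B \<omega>) * (e A \<omega> - e B \<omega>))"
      by (auto simp: power2_eq_square max_def)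
  qed measurable
  define Q where "Q k = (\<integral>\<omega>. (e {} \<omega> - e {k} \<omega>)\<^sup>2 \<partial>N)" for k
  have telescope: "(\<integral>\<omega>. e {} \<omega> * (e {} \<omega> - e T \<omega>) \<partial>N) \<le> (\<Sum>k\<in>T. Q k) / 2" if "T \<subseteq> I" for T
    using finite_subset[OF that I(1)] that
  proof (induction T rule: finite_induct)
    case empty
    then show ?case by simp
  next
    case (insert k T)
    have sd: "sym_diff {} {k} = {k}" "sym_diff T {k} = insert k T" "sym_diff (insert k T) {k} = T"
      "sym_diff {} T = T" "sym_diff {k} T = insert k T"
      using insert.hyps(2) by auto
    \<comment> \<open>Exchanging the copies at \<open>k\<close> swaps \<open>{}\<close> with
      \<open>{k}\<close> and \<open>T\<close> with \<open>insert k T\<close>. Averaging the two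
      forms turns twice the increment into the expectation of a product of two differences.\<close>
    have 1: "(\<integral>\<omega>. e {} \<omega> * (e T \<omega> - e (insert k T) \<omega>) \<partial>N) = (\<integral>\<omega>. e {k} \<omega> * (e (insert k T) \<omega> - e T \<omega>) \<partial>N)"
      using int_flip[of "\<lambda>\<omega>. e {} \<omega> * (e T \<omega> - e (insert k T) \<omega>)" "{k}"] unfolding e_flip sd by simp
    \<comment> \<open>Exchanging the copies on \<open>T\<close> carries the pair \<open>{}\<close>,
      \<open>{k}\<close> to \<open>T\<close>, \<open>insert k T\<close>, so both factors of that
      product have second moment \<open>Q k\<close>.\<close>
    have 2: "(\<integral>\<omega>. (e T \<omega> - e (insert k T) \<omega>)\<^sup>2 \<partial>N) = Q k"
      using int_flip[of "\<lambda>\<omega>. (e {} \<omega> - e {k} \<omega>)\<^sup>2" T] unfolding e_flip sd Q_def by simp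
    have i1: "integrable N (\<lambda>\<omega>. e A \<omega> * (e B \<omega> - e B' \<omega>))" for A B B'
      unfolding right_diff_distrib by (intro Bochner_Integration.integrable_diff int2)
    have i2: "integrable N (\<lambda>\<omega>. (e A \<omega> - e B \<omega>)\<^sup>2)" for A B
      unfolding power2_eq_square by (rule int1)
    have "2 * (\<integral>\<omega>. e {} \<omega> * (e T \<omega> - e (insert k T) \<omega>) \<partial>N)
        = (\<integral>\<omega>. e {} \<omega> * (e T \<omega> - e (insert k T) \<omega>) \<partial>N) + (\<integral>\<omega>. e {k} \<omega> * (e (insert k T) \<omega> - e T \<omega>) \<partial>N)"
      using 1 by simp
    also have "\<dots> = (\<integral>\<omega>. e {} \<omega> * (e T \<omega> - e (insert k T) \<omega>) + e {k} \<omega> * (e (insert k T) \<omega> - e T \<omega>) \<partial>N)"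
      by (intro Bochner_Integration.integral_add[symmetric] i1)
    also have "\<dots> = (\<integral>\<omega>. (e {} \<omega> - e {k} \<omega>) * (e T \<omega> - e (insert k T) \<omega>) \<partial>N)"
      by (simp add: algebra_simps)
    also have "\<dots> \<le> (\<integral>\<omega>. ((e {} \<omega> - e {k} \<omega>)\<^sup>2 + (e T \<omega> - e (insert k T) \<omega>)\<^sup>2) / 2 \<partial>N)"
    proof (rule integral_mono)
      show "integrable N (\<lambda>\<omega>. (e {} \<omega> - e {k} \<omega>) * (e T \<omega> - e (insert k T) \<omega>))" by (rule int1)
      show "integrable N (\<lambda>\<omega>. ((e {} \<omega> - e {k} \<omega>)\<^sup>2 + (e T \<omega> - e (insert k T) \<omega>)\<^sup>2) / 2)"
        by (intro integrable_divide Bochner_Integration.integrable_add i2)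
      have "a * b \<le> (a\<^sup>2 + b\<^sup>2) / 2" for a b :: real
        using sum_squares_bound[of a b] by simp
      then show "(e {} \<omega> - e {k} \<omega>) * (e T \<omega> - e (insert k T) \<omega>)
          \<le> ((e {} \<omega> - e {k} \<omega>)\<^sup>2 + (e T \<omega> - e (insert k T) \<omega>)\<^sup>2) / 2" for \<omega> .
    qed
    also have "\<dots> = Q k"
      using i2 2 by (simp add: Bochner_Integration.integral_add Q_def[symmetric])
    finally have step: "(\<integral>\<omega>. e {} \<omega> * (e T \<omega> - e (insert k T) \<omega>) \<partial>N) \<le> Q k / 2" by simp
    have "(\<integral>\<omega>. e {} \<omega> * (e {} \<omega> - e (insert k T) \<omega>) \<partial>N)
        = (\<integral>\<omega>. e {} \<omega> * (e {} \<omega> - e T \<omega>) + e {} \<omega> * (e T \<omega> - e (insert k T) \<omega>) \<partial>N)"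
      by (simp add: algebra_simps)
    also have "\<dots> = (\<integral>\<omega>. e {} \<omega> * (e {} \<omega> - e T \<omega>) \<partial>N) + (\<integral>\<omega>. e {} \<omega> * (e T \<omega> - e (insert k T) \<omega>) \<partial>N)"
      by (intro Bochner_Integration.integral_add i1)
    also have "\<dots> \<le> (\<Sum>k\<in>T. Q k) / 2 + Q k / 2"
      using insert.IH insert.prems step by auto
    finally show ?case using insert.hyps by (simp add: add_divide_distrib)
  qed
  \<comment> \<open>The square splits into the squared positive parts of the difference and of its
    negative; exchanging the copies at \<open>k\<close> shows that they have equal
    expectation.\<close>
  have Q_half: "Q k = 2 * (\<integral>\<omega>. (max 0 (e {} \<omega> - e {k} \<omega>))\<^sup>2 \<partial>N)" for k
  proof -
    have "Q k = (\<integral>\<omega>. (max 0 (e {} \<omega> - e {k} \<omega>))\<^sup>2 + (max 0 (e {k} \<omega> - e {} \<omega>))\<^sup>2 \<partial>N)"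
      unfolding Q_def by (intro Bochner_Integration.integral_cong refl) (auto simp: max_def power2_commute)
    also have "\<dots> = (\<integral>\<omega>. (max 0 (e {} \<omega> - e {k} \<omega>))\<^sup>2 \<partial>N) + (\<integral>\<omega>. (max 0 (e {k} \<omega> - e {} \<omega>))\<^sup>2 \<partial>N)"
      by (intro Bochner_Integration.integral_add int3)
    also have "(\<integral>\<omega>. (max 0 (e {k} \<omega> - e {} \<omega>))\<^sup>2 \<partial>N) = (\<integral>\<omega>. (max 0 (e {} \<omega> - e {k} \<omega>))\<^sup>2 \<partial>N)"
      using int_flip[of "\<lambda>\<omega>. (max 0 (e {} \<omega> - e {k} \<omega>))\<^sup>2" "{k}"] by (simp add: e_flip)
    finally show ?thesis by simp
  qed
  have "(\<Sum>k\<in>I. Q k) / 2 = (\<integral>\<omega>. (\<Sum>k\<in>I. (max 0 (e {} \<omega> - e {k} \<omega>))\<^sup>2) \<partial>N)"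
    by (subst Bochner_Integration.integral_sum[OF int3]) (simp add: Q_half sum_distrib_left[symmetric])
  also have "\<dots> \<le> (\<integral>\<omega>. K \<partial>N)"
  proof (intro integral_mono Bochner_Integration.integrable_sum int3)
    fix \<omega> assume \<omega>: "\<omega> \<in> space N"
    \<comment> \<open>Resampling only \<open>k\<close> replaces that coordinate of the original
      sample by the one of the full copy \<open>mix I\<close>, so the pointwise hypothesis on
      \<open>K\<close> applies.\<close>
    have "mix {k} \<omega> = (mix {} \<omega>)(k := mix I \<omega> k)" if "k \<in> I" for k
      using that by (auto simp: mix_def fun_eq_iff)
    then have "(\<Sum>k\<in>I. (max 0 (e {} \<omega> - e {k} \<omega>))\<^sup>2)
        = (\<Sum>k\<in>I. (max 0 (g (mix {} \<omega>) - g ((mix {} \<omega>)(k := mix I \<omega> k))))\<^sup>2)"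
      by (simp add: e_def)
    also have "\<dots> \<le> K"
      by (intro K measurable_space[OF mix_meas \<omega>])
    finally show "(\<Sum>k\<in>I. (max 0 (e {} \<omega> - e {k} \<omega>))\<^sup>2) \<le> K" .
  qed simp
  finally have QK: "(\<Sum>k\<in>I. Q k) / 2 \<le> K" by (simp add: N.prob_space)

  have int_e: "(\<integral>\<omega>. h (mix T \<omega>) \<partial>N) = integral\<^sup>L (Pi\<^sub>M I \<mu>) h" if "h \<in> borel_measurable (Pi\<^sub>M I \<mu>)"
    for T and h :: "_ \<Rightarrow> real"
    using integral_distr[OF mix_meas that, of T] by (simp add: mix_distr)
  \<comment> \<open>\<open>e {}\<close> and \<open>e I\<close> read disjoint sets of coordinates and
    are independent; hence the telescoped covariance for \<open>T = I\<close> is the variance of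
    \<open>g\<close>.\<close>
  have prodE: "(\<integral>\<omega>. e {} \<omega> * e I \<omega> \<partial>N) = (integral\<^sup>L (Pi\<^sub>M I \<mu>) g)\<^sup>2"
  proof -
    let ?A = "I \<times> {False}" and ?B = "I \<times> {True}"
    have "N.indep_vars \<nu> (\<lambda>p \<omega>. \<omega> p) ?J"
      unfolding N_def by (rule indep_vars_PiM_coordinates) (use I(2) in \<open>auto simp: \<nu>_def \<mu>\<close>)
    then have ind: "N.indep_var (Pi\<^sub>M ?A \<nu>) (\<lambda>\<omega>. \<lambda>p\<in>?A. \<omega> p) (Pi\<^sub>M ?B \<nu>) (\<lambda>\<omega>. \<lambda>p\<in>?B. \<omega> p)"
      by (rule N.indep_var_restrict) auto
    have sel: "(\<lambda>x. \<lambda>i\<in>I. x (i, b)) \<in> Pi\<^sub>M (I \<times> {b}) \<nu> \<rightarrow>\<^sub>M Pi\<^sub>M I \<mu>" for b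
    proof (intro measurable_restrict)
      fix i assume "i \<in> I"
      then show "(\<lambda>x. x (i, b)) \<in> Pi\<^sub>M (I \<times> {b}) \<nu> \<rightarrow>\<^sub>M \<mu> i"
        using measurable_component_singleton[of "(i, b)" "I \<times> {b}" \<nu>] by (simp add: \<nu>_def)
    qed
    have m: "(\<lambda>x. g (\<lambda>i\<in>I. x (i, b))) \<in> borel_measurable (Pi\<^sub>M (I \<times> {b}) \<nu>)" for b
      by (rule measurable_compose[OF sel g])
    have eF: "e {} = (\<lambda>x. g (\<lambda>i\<in>I. x (i, False))) \<circ> (\<lambda>\<omega>. \<lambda>p\<in>?A. \<omega> p)"
      by (auto simp: e_def mix_def fun_eq_iff intro!: arg_cong[where f = g])
    have eT: "e I = (\<lambda>x. g (\<lambda>i\<in>I. x (i, True))) \<circ> (\<lambda>\<omega>. \<lambda>p\<in>?B. \<omega> p)"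
      by (auto simp: e_def mix_def fun_eq_iff intro!: arg_cong[where f = g])
    have "N.indep_var borel (e {}) borel (e I)"
      unfolding eF eT by (rule N.indep_var_compose[OF ind m m])
    moreover have "integrable N (e T)" for T
      by (rule N.integrable_const_bound[of _ C]) (auto intro!: AE_I2 e_bdd)
    ultimately have "(\<integral>\<omega>. e {} \<omega> * e I \<omega> \<partial>N) = integral\<^sup>L N (e {}) * integral\<^sup>L N (e I)"
      by (intro N.indep_var_lebesgue_integral)
    then show ?thesis by (simp add: e_def[abs_def] int_e[OF g] power2_eq_square)
  qed
  have "(\<integral>\<omega>. e {} \<omega> * (e {} \<omega> - e I \<omega>) \<partial>N) = (\<integral>\<omega>. e {} \<omega> * e {} \<omega> \<partial>N) - (\<integral>\<omega>. e {} \<omega> * e I \<omega> \<partial>N)"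
    unfolding right_diff_distrib by (intro Bochner_Integration.integral_diff int2)
  also have "\<dots> = (\<integral>x. (g x)\<^sup>2 \<partial>Pi\<^sub>M I \<mu>) - (integral\<^sup>L (Pi\<^sub>M I \<mu>) g)\<^sup>2"
    unfolding prodE using int_e[of "\<lambda>x. (g x)\<^sup>2" "{}"] by (simp add: e_def power2_eq_square)
  also have "\<dots> = (\<integral>x. (g x - integral\<^sup>L (Pi\<^sub>M I \<mu>) g)\<^sup>2 \<partial>Pi\<^sub>M I \<mu>)"
  proof (rule P.variance_eq[symmetric])
    show "integrable (Pi\<^sub>M I \<mu>) g"
      by (rule P.integrable_const_bound[of _ C]) (auto intro!: AE_I2 bdd)
    show "integrable (Pi\<^sub>M I \<mu>) (\<lambda>x. (g x)\<^sup>2)"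
    proof (rule P.integrable_const_bound[of _ "C\<^sup>2"])
      show "AE x in Pi\<^sub>M I \<mu>. norm ((g x)\<^sup>2) \<le> C\<^sup>2"
        by (intro AE_I2) (use bdd C0 in \<open>auto simp: abs_le_square_iff[symmetric]\<close>)
    qed measurable
  qed
  finally show ?thesis using telescope[OF order.refl] QK by linarith
qed

text \<open>Independence identifies the joint law of the \<open>V i\<close> with a product measure,
  to which the product space version applies.\<close>

lemma (in prob_space) efron_stein:
  fixes g :: "('i \<Rightarrow> 'b) \<Rightarrow> real"
  assumes I: "finite I" "I \<noteq> {}" and ind: "indep_vars N V I"
    and g: "g \<in> borel_measurable (Pi\<^sub>M I N)"
    and bdd: "\<And>x. x \<in> space (Pi\<^sub>M I N) \<Longrightarrow> \<bar>g x\<bar> \<le> C"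
    and K: "\<And>x y. x \<in> space (Pi\<^sub>M I N) \<Longrightarrow> y \<in> space (Pi\<^sub>M I N) \<Longrightarrow>
      (\<Sum>i\<in>I. (max 0 (g x - g (x(i := y i))))\<^sup>2) \<le> K"
  shows "variance (\<lambda>\<omega>. g (\<lambda>i\<in>I. V i \<omega>)) \<le> K"
proof -
  have rv: "V i \<in> M \<rightarrow>\<^sub>M N i" if "i \<in> I" for i
    using ind that by (auto simp: indep_vars_def)
  let ?V = "\<lambda>\<omega>. \<lambda>i\<in>I. V i \<omega>"
  have Vm: "?V \<in> M \<rightarrow>\<^sub>M Pi\<^sub>M I N" by (intro measurable_restrict rv)
  obtain i0 where i0: "i0 \<in> I" using I by auto
  \<comment> \<open>The product space version asks for a probability measure at every index, so the
    law of a fixed \<open>V i0\<close> fills the indices outside \<open>I\<close>.\<close>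
  define \<nu> where "\<nu> i = (if i \<in> I then distr M (N i) (V i) else distr M (N i0) (V i0))" for i
  have \<nu>: "prob_space (\<nu> i)" for i
    unfolding \<nu>_def using rv i0 by (auto intro: prob_space_distr)
  have d: "distr M (Pi\<^sub>M I N) ?V = Pi\<^sub>M I \<nu>"
    using ind indep_vars_iff_distr_eq_PiM'[OF I(2), where M' = N and X = V] rv
    by (simp add: \<nu>_def cong: PiM_cong)
  have s: "sets (Pi\<^sub>M I \<nu>) = sets (Pi\<^sub>M I N)" unfolding d[symmetric] by simp
  have sp: "space (Pi\<^sub>M I \<nu>) = space (Pi\<^sub>M I N)" by (rule sets_eq_imp_space_eq[OF s])
  have g': "g \<in> borel_measurable (Pi\<^sub>M I \<nu>)"
    using g measurable_cong_sets[OF s refl] by blast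
  have E: "expectation (\<lambda>\<omega>. h (?V \<omega>)) = integral\<^sup>L (Pi\<^sub>M I \<nu>) h" if "h \<in> borel_measurable (Pi\<^sub>M I N)"
    for h :: "_ \<Rightarrow> real"
    using integral_distr[OF Vm that] by (simp add: d)
  have "(\<integral>x. (g x - integral\<^sup>L (Pi\<^sub>M I \<nu>) g)\<^sup>2 \<partial>Pi\<^sub>M I \<nu>) \<le> K"
    by (rule efron_stein_PiM[OF I \<nu> g', of C]) (use bdd K in \<open>auto simp: sp\<close>)
  then show ?thesis
    using E[of "\<lambda>x. (g x - integral\<^sup>L (Pi\<^sub>M I \<nu>) g)\<^sup>2"] g by (simp add: E[OF g])
qed

subsection \<open>Approximation by absolute values\<close>

text \<open>Half the second difference of \<open>\<bar>y - s\<bar>\<close> in \<open>s\<close> at an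
  integer \<open>k\<close> is the hat function centred at \<open>k\<close>. At each \<open>y\<close>
  only the hats at the two neighbouring integers can be nonzero, with the linear interpolation
  weights.\<close>

lemma hat_function_values:
  fixes y :: real and k :: int
  shows "(\<bar>y - (of_int k - 1)\<bar> + \<bar>y - (of_int k + 1)\<bar> - 2 * \<bar>y - of_int k\<bar>) / 2 =
    (if k = \<lfloor>y\<rfloor> then 1 - frac y else if k = \<lfloor>y\<rfloor> + 1 then frac y else 0)"
proof -
  have fr: "y = of_int \<lfloor>y\<rfloor> + frac y" "0 \<le> frac y" "frac y < 1"
    by (auto simp: frac_def frac_lt_1[unfolded frac_def])
  consider "k = \<lfloor>y\<rfloor>" | "k = \<lfloor>y\<rfloor> + 1" | "k \<le> \<lfloor>y\<rfloor> - 1" | "k \<ge> \<lfloor>y\<rfloor> + 2" by linarith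
  then show ?thesis
  proof cases
    case 3
    then have "real_of_int k \<le> of_int \<lfloor>y\<rfloor> - 1" by linarith
    then have "1 \<le> y - of_int k" using fr by linarith
    with 3 show ?thesis by simp
  next
    case 4
    then have "real_of_int k \<ge> of_int \<lfloor>y\<rfloor> + 2" by linarith
    then have "1 \<le> of_int k - y" using fr by linarith
    with 4 show ?thesis by simp
  next
    case 1
    then have *: "y - (of_int k - 1) = frac y + 1" "y - (of_int k + 1) = frac y - 1" "y - of_int k = frac y"
      by (simp_all add: frac_def)
    show ?thesis unfolding * using 1 fr(2,3) by simp
  next
    case 2
    then have *: "y - (of_int k - 1) = frac y" "y - (of_int k + 1) = frac y - 2" "y - of_int k = frac y - 1"
      by (simp_all add: frac_def)
    show ?thesis unfolding * using 2 fr(2,3) by simp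
  qed
qed

text \<open>Piecewise linear interpolation, written as a combination of the convex functions
  \<open>\<bar>x - t\<bar>\<close> by expanding each hat function.\<close>
lemma lipschitz_compact_support_abs_approx:
  fixes f :: "real \<Rightarrow> real"
  assumes lip: "1-lipschitz_on UNIV f" and supp: "compact (closure {x. f x \<noteq> 0})" and \<delta>: "\<delta> > 0"
  obtains J :: "(int \<times> int) set" and c t :: "int \<times> int \<Rightarrow> real"
  where "finite J" "\<And>x. \<bar>f x - (\<Sum>j\<in>J. c j * \<bar>x - t j\<bar>)\<bar> \<le> \<delta>"
proof -
  obtain R where R: "\<And>x. x \<in> closure {x. f x \<noteq> 0} \<Longrightarrow> \<bar>x\<bar> \<le> R"
    using compact_imp_bounded[OF supp] by (auto simp: bounded_iff)
  have f0: "f x = 0" if "\<bar>x\<bar> > R" for x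
    using R[of x] closure_subset[of "{x. f x \<noteq> 0}"] that by fastforce
  \<comment> \<open>The grid has mesh \<open>\<delta>\<close>; nodes with index outside
    \<open>K\<close> lie beyond the radius \<open>R\<close> of the support.\<close>
  define N where "N = \<lceil>R / \<delta>\<rceil>"
  define K where "K = {- N..N}"
  have fK: "f (of_int k * \<delta>) = 0" if "k \<notin> K" for k :: int
  proof (rule f0)
    have "N + 1 \<le> \<bar>k\<bar>" using that by (auto simp: K_def)
    then have "real_of_int N + 1 \<le> \<bar>real_of_int k\<bar>" by linarith
    moreover have "R / \<delta> \<le> real_of_int N" by (simp add: N_def)
    ultimately have "R / \<delta> < \<bar>real_of_int k\<bar>" by linarith
    then show "R < \<bar>of_int k * \<delta>\<bar>" using \<delta> by (simp add: field_simps abs_mult)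
  qed
  define h where "h k x = (\<bar>x - (of_int k - 1) * \<delta>\<bar> + \<bar>x - (of_int k + 1) * \<delta>\<bar> - 2 * \<bar>x - of_int k * \<delta>\<bar>) / (2 * \<delta>)"
    for k :: int and x
  have h: "h k x = (if k = \<lfloor>x / \<delta>\<rfloor> then 1 - frac (x / \<delta>) else if k = \<lfloor>x / \<delta>\<rfloor> + 1 then frac (x / \<delta>) else 0)" for k x
  proof -
    have "\<bar>x - s * \<delta>\<bar> = \<delta> * \<bar>x / \<delta> - s\<bar>" for s
    proof -
      have "x - s * \<delta> = \<delta> * (x / \<delta> - s)" using \<delta> by (simp add: field_simps)
      then show ?thesis using \<delta> by (simp add: abs_mult)
    qed
    then have "h k x = (\<bar>x / \<delta> - (of_int k - 1)\<bar> + \<bar>x / \<delta> - (of_int k + 1)\<bar> - 2 * \<bar>x / \<delta> - of_int k\<bar>) / 2"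
      using \<delta> by (simp add: h_def field_simps)
    then show ?thesis unfolding hat_function_values .
  qed
  \<comment> \<open>Each hat is a combination of three absolute values; the second component of an
    index is the shift of the kink from node \<open>k\<close>.\<close>
  define J where "J = K \<times> {- 1, 0, 1 :: int}"
  define c where "c j = f (of_int (fst j) * \<delta>) * (if snd j = 0 then - 1 / \<delta> else 1 / (2 * \<delta>))" for j :: "int \<times> int"
  define t where "t j = of_int (fst j + snd j) * \<delta>" for j :: "int \<times> int"
  have comb: "(\<Sum>j\<in>J. c j * \<bar>x - t j\<bar>) = (\<Sum>k\<in>K. f (of_int k * \<delta>) * h k x)" for x
  proof -
    have "(\<Sum>j\<in>J. c j * \<bar>x - t j\<bar>) = (\<Sum>k\<in>K. \<Sum>s\<in>{- 1, 0, 1}. c (k, s) * \<bar>x - t (k, s)\<bar>)"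
      unfolding J_def sum.cartesian_product by (intro sum.cong) auto
    also have "\<dots> = (\<Sum>k\<in>K. f (of_int k * \<delta>) * h k x)"
      using \<delta> by (intro sum.cong refl) (simp add: c_def t_def h_def field_simps)
    finally show ?thesis .
  qed
  show thesis
  proof (rule that[of J c t])
    show "finite J" by (simp add: J_def K_def)
    fix x
    define q where "q = \<lfloor>x / \<delta>\<rfloor>"
    define \<theta> where "\<theta> = frac (x / \<delta>)"
    have \<theta>: "0 \<le> \<theta>" "\<theta> \<le> 1" by (auto simp: \<theta>_def less_imp_le[OF frac_lt_1])
    have x: "x = (of_int q + \<theta>) * \<delta>" using \<delta> by (simp add: q_def \<theta>_def frac_def)
    \<comment> \<open>The nodes \<open>q\<close> and \<open>q + 1\<close> around \<open>x\<close>
      may fall outside \<open>K\<close>. Adding them is harmless because \<open>f\<close> vanishes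
      there, and all other hats vanish at \<open>x\<close>.\<close>
    have "(\<Sum>k\<in>K. f (of_int k * \<delta>) * h k x) = (\<Sum>k\<in>K \<union> {q, q + 1}. f (of_int k * \<delta>) * h k x)"
      by (intro sum.mono_neutral_left) (auto simp: K_def[symmetric] fK, simp add: K_def)
    also have "\<dots> = (\<Sum>k\<in>{q, q + 1}. f (of_int k * \<delta>) * h k x)"
      by (intro sum.mono_neutral_right) (auto simp: h q_def K_def)
    also have "\<dots> = f (of_int q * \<delta>) * (1 - \<theta>) + f (of_int (q + 1) * \<delta>) * \<theta>"
      by (simp add: h q_def \<theta>_def)
    finally have s: "(\<Sum>j\<in>J. c j * \<bar>x - t j\<bar>) = f (of_int q * \<delta>) * (1 - \<theta>) + f (of_int (q + 1) * \<delta>) * \<theta>"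
      by (simp add: comb)
    have L: "\<bar>f x - f y\<bar> \<le> \<bar>x - y\<bar>" for y
      using lipschitz_onD[OF lip, of x y] by (simp add: dist_real_def)
    have "\<bar>x - of_int q * \<delta>\<bar> \<le> \<delta>" "\<bar>x - of_int (q + 1) * \<delta>\<bar> \<le> \<delta>"
    proof -
      have "x - of_int q * \<delta> = \<theta> * \<delta>" "x - of_int (q + 1) * \<delta> = - ((1 - \<theta>) * \<delta>)"
        by (simp_all add: x algebra_simps)
      then show "\<bar>x - of_int q * \<delta>\<bar> \<le> \<delta>" "\<bar>x - of_int (q + 1) * \<delta>\<bar> \<le> \<delta>"
        using \<theta> \<delta> by (simp_all add: abs_mult mult_le_cancel_right1)
    qed
    with L have 1: "\<bar>f x - f (of_int q * \<delta>)\<bar> \<le> \<delta>" "\<bar>f x - f (of_int (q + 1) * \<delta>)\<bar> \<le> \<delta>"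
      by (meson order_trans)+
    \<comment> \<open>The error is a convex combination of two increments of \<open>f\<close> over
      distances at most \<open>\<delta>\<close>.\<close>
    have "\<bar>f x - (\<Sum>j\<in>J. c j * \<bar>x - t j\<bar>)\<bar>
        = \<bar>(1 - \<theta>) * (f x - f (of_int q * \<delta>)) + \<theta> * (f x - f (of_int (q + 1) * \<delta>))\<bar>"
      unfolding s by (simp add: algebra_simps)
    also have "\<dots> \<le> \<bar>(1 - \<theta>) * (f x - f (of_int q * \<delta>))\<bar> + \<bar>\<theta> * (f x - f (of_int (q + 1) * \<delta>))\<bar>"
      by (rule abs_triangle_ineq)
    also have "\<dots> \<le> (1 - \<theta>) * \<delta> + \<theta> * \<delta>"
      unfolding abs_mult using \<theta> 1 by (intro add_mono mult_mono) auto
    finally show "\<bar>f x - (\<Sum>j\<in>J. c j * \<bar>x - t j\<bar>)\<bar> \<le> \<delta>" by (simp add: algebra_simps)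
  qed
qed

text \<open>The spectral integral is an average over eigenvalues, so a uniform error bound passes to
  it with the same constant, whatever \<open>n\<close> is.\<close>

lemma esd_integral_abs_approx:
  assumes A: "hermitian_mat n A" and n: "n > 0"
    and approx: "\<And>x. \<bar>f x - (\<Sum>j\<in>J. c j * \<bar>x - t j\<bar>)\<bar> \<le> \<delta>"
  shows "\<bar>esd_integral f A - (\<Sum>j\<in>J. c j * esd_integral (\<lambda>z. \<bar>z - t j\<bar>) A)\<bar> \<le> \<delta>"
proof -
  obtain P l where ud: "unitary_diag n A P l"
    using hermitian_spectral[OF A] unfolding unitary_diag_def by metis
  have "(\<Sum>j\<in>J. c j * esd_integral (\<lambda>z. \<bar>z - t j\<bar>) A) = (\<Sum>j\<in>J. \<Sum>k<n. c j * \<bar>l k - t j\<bar>) / real n"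
    unfolding esd_integral_unitary_diag[OF ud] by (simp add: sum_distrib_left sum_divide_distrib)
  also have "(\<Sum>j\<in>J. \<Sum>k<n. c j * \<bar>l k - t j\<bar>) = (\<Sum>k<n. \<Sum>j\<in>J. c j * \<bar>l k - t j\<bar>)"
    by (rule sum.swap)
  finally have "esd_integral f A - (\<Sum>j\<in>J. c j * esd_integral (\<lambda>z. \<bar>z - t j\<bar>) A)
      = (\<Sum>k<n. f (l k) - (\<Sum>j\<in>J. c j * \<bar>l k - t j\<bar>)) / real n"
    unfolding esd_integral_unitary_diag[OF ud] by (simp add: sum_subtractf diff_divide_distrib)
  also have "\<bar>\<dots>\<bar> \<le> (\<Sum>k<n. \<delta>) / real n"
    unfolding abs_divide using approx
    by (intro divide_mono order.trans[OF sum_abs] sum_mono) (use n in auto)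
  finally show ?thesis using n by simp
qed

lemma esd_integral_bounded:
  assumes A: "hermitian_mat n A" and n: "n > 0" and F: "\<And>x. \<bar>f x\<bar> \<le> F"
  shows "\<bar>esd_integral f A\<bar> \<le> F"
  using esd_integral_abs_approx[OF A n, where f = f and J = "{} :: unit set" and \<delta> = F] F by simp

subsection \<open>Truncation and concentration\<close>

text \<open>Large entries are set to zero rather than clipped, so that \<open>z - trunc r z\<close>
  is exactly the part of the entry counted in \<open>prop_L\<close>.\<close>

definition trunc :: "real \<Rightarrow> complex \<Rightarrow> complex" where
  "trunc r z = (if cmod z \<le> r then z else 0)"

lemma trunc_measurable [measurable]: "trunc r \<in> borel_measurable borel"
  unfolding trunc_def by measurable

lemma norm_trunc: "0 \<le> r \<Longrightarrow> cmod (trunc r z) \<le> r"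
  by (simp add: trunc_def)

text \<open>The entries outside the \<open>n \<times> n\<close> square are unspecified, hence the padding by zero.\<close>
definition entries :: "nat \<Rightarrow> complex mat \<Rightarrow> nat \<times> nat \<Rightarrow> complex" where
  "entries n A p = (if p \<in> {..<n} \<times> {..<n} then A $$ p else 0)"

lemma abs_stat_entries:
  assumes "hermitian_mat n A"
  shows "abs_stat n t (entries n A) = esd_integral (\<lambda>z. \<bar>z - t\<bar>) ((1 / sqrt (real n)) \<cdot>\<^sub>m A)"
proof -
  have "hpart n (entries n A) = hpart n (\<lambda>p. A $$ p)"
    by (intro eq_matI) (auto simp: hpart_def entries_def)
  then show ?thesis by (simp add: abs_stat_def hpart_hermitian[OF assms])
qed

text \<open>Comparison with the zero array by the Lipschitz estimate. The bound provides the
  boundedness demanded by \<open>efron_stein\<close> and does not enter the variance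
  estimate.\<close>

lemma abs_stat_bounded:
  assumes n: "n > 0" and r: "0 \<le> r" and z: "\<And>p. cmod (z p) \<le> r"
  shows "\<bar>abs_stat n t z\<bar> \<le> \<bar>abs_stat n t (\<lambda>_. 0)\<bar> + r"
proof -
  have "(\<Sum>p\<in>{..<n} \<times> {..<n}. (cmod (z p - 0))\<^sup>2) \<le> (\<Sum>p\<in>{..<n} \<times> {..<n}. r\<^sup>2)"
    by (intro sum_mono power_mono) (simp_all add: z)
  also have "\<dots> = (real n * r)\<^sup>2" by (simp add: power2_eq_square)
  finally have "sqrt (\<Sum>p\<in>{..<n} \<times> {..<n}. (cmod (z p - 0))\<^sup>2) \<le> real n * r"
    using r by (intro real_le_lsqrt) (auto intro: sum_nonneg)
  then have "sqrt (\<Sum>p\<in>{..<n} \<times> {..<n}. (cmod (z p - 0))\<^sup>2) / real n \<le> r"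
    using n by (simp add: field_simps)
  with abs_stat_lipschitz[OF n, of t z "\<lambda>_. 0"] show ?thesis by linarith
qed

lemma (in prob_space) variance_abs_stat_trunc:
  assumes n: "n > 0" and r: "0 \<le> r" and S: "prop_S M n n X d"
  shows "variance (\<lambda>\<omega>. abs_stat n t (\<lambda>p. trunc r (entries n (X \<omega>) p))) \<le> 4 * r\<^sup>2 * real d / (real n)\<^sup>2"
proof -
  let ?I = "{..<n} \<times> {..<n}"
  obtain P where P: "partition_on ?I P" and card: "\<And>B. B \<in> P \<Longrightarrow> card B \<le> d"
    and ind: "indep_vars (\<lambda>B. PiM B (\<lambda>_. borel :: complex measure)) (\<lambda>B \<omega>. restrict (\<lambda>ij. X \<omega> $$ ij) B) P"
    using S unfolding prop_S_def by blast
  have UP: "?I = \<Union>P" by (rule partition_onD1[OF P])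
  have dP: "disjoint P" by (rule partition_onD2[OF P])
  have finP: "finite P" by (rule finite_elements[OF _ P]) simp
  have finB: "finite B" if "B \<in> P" for B
  proof (rule finite_subset)
    show "B \<subseteq> ?I" unfolding UP using that by auto
  qed simp
  have P0: "P \<noteq> {}" using UP n by auto
  define blk where "blk p = (THE B. B \<in> P \<and> p \<in> B)" for p
  have blk: "blk p = B" if "B \<in> P" "p \<in> B" for B p
    unfolding blk_def using that dP by (intro the_equality) (auto simp: disjoint_def)
  have blk': "blk p \<in> P" "p \<in> blk p" if "p \<in> ?I" for p
  proof -
    from that obtain B where "B \<in> P" "p \<in> B" unfolding UP by blast
    then show "blk p \<in> P" "p \<in> blk p" using blk[of B p] by simp_all
  qed
  let ?N = "\<lambda>B. PiM B (\<lambda>_. borel :: complex measure)"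
  \<comment> \<open>Reassembles an array from its block vectors. Truncating here makes the entry
    bound hold at every point of the product space, including all resampled ones.\<close>
  define z where "z x p = (if p \<in> ?I then trunc r (x (blk p) p) else 0)"
    for x :: "(nat \<times> nat) set \<Rightarrow> nat \<times> nat \<Rightarrow> complex" and p
  define g where "g x = abs_stat n t (z x)" for x
  have zr: "cmod (z x p) \<le> r" for x p using r by (simp add: z_def norm_trunc)
  have z_meas: "z \<in> PiM P ?N \<rightarrow>\<^sub>M PiM UNIV (\<lambda>_. borel)"
  proof -
    have "(\<lambda>x. z x p) \<in> borel_measurable (PiM P ?N)" for p
    proof (cases "p \<in> ?I")
      case True
      have "(\<lambda>x. x (blk p) p) \<in> borel_measurable (PiM P ?N)"
        using measurable_compose[OF measurable_component_singleton[OF blk'(1)[OF True], of ?N]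
            measurable_component_singleton[OF blk'(2)[OF True], of "\<lambda>_. borel"]] .
      then show ?thesis using True unfolding z_def by simp
    qed (unfold z_def, simp)
    then show ?thesis by (rule measurable_abs_UNIV[of "\<lambda>p x. z x p"])
  qed
  have g_meas: "g \<in> borel_measurable (PiM P ?N)"
    unfolding g_def by (rule measurable_compose[OF z_meas abs_stat_measurable[OF n]])
  have "variance (\<lambda>\<omega>. g (\<lambda>B\<in>P. restrict (\<lambda>ij. X \<omega> $$ ij) B)) \<le> 4 * r\<^sup>2 * real d / (real n)\<^sup>2"
  proof (rule efron_stein[OF finP P0 ind g_meas])
    show "\<bar>g x\<bar> \<le> \<bar>abs_stat n t (\<lambda>_. 0)\<bar> + r" for x
      unfolding g_def by (rule abs_stat_bounded[OF n r zr])
    fix x y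
    \<comment> \<open>One subgradient at \<open>z x\<close> serves all blocks, so the squared
      weights can later be summed over the whole partition.\<close>
    obtain u where u0: "\<And>p. 0 \<le> u p" and u2: "(\<Sum>p\<in>?I. (u p)\<^sup>2) \<le> 1 / (real n)\<^sup>2"
      and u: "\<And>w. abs_stat n t (z x) - abs_stat n t w \<le> (\<Sum>p\<in>?I. u p * cmod (z x p - w p))"
      using abs_stat_subgradient[OF n, of t "z x"] by blast
    have sumP: "(\<Sum>p\<in>?I. h p) = (\<Sum>B\<in>P. \<Sum>p\<in>B. h p)" for h :: "_ \<Rightarrow> real"
      unfolding UP by (rule sum.Union_disjoint[unfolded comp_def]) (use finB dP in \<open>auto simp: disjoint_def\<close>)
    have B: "(max 0 (g x - g (x(B := y B))))\<^sup>2 \<le> 4 * r\<^sup>2 * real d * (\<Sum>p\<in>B. (u p)\<^sup>2)" if BP: "B \<in> P" for B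
    proof -
      have zB: "z (x(B := y B)) p = z x p" if "p \<in> ?I - B" for p
        using that blk'[of p] by (auto simp: z_def)
      have "g x - g (x(B := y B)) \<le> (\<Sum>p\<in>?I. u p * cmod (z x p - z (x(B := y B)) p))"
        unfolding g_def by (rule u)
      also have "\<dots> = (\<Sum>p\<in>B. u p * cmod (z x p - z (x(B := y B)) p))"
      proof (rule sum.mono_neutral_right)
        show "B \<subseteq> ?I" unfolding UP using BP by auto
        show "\<forall>p\<in>?I - B. u p * cmod (z x p - z (x(B := y B)) p) = 0" by (simp add: zB)
      qed simp
      also have "\<dots> \<le> (\<Sum>p\<in>B. u p * (2 * r))"
      proof (intro sum_mono mult_left_mono u0)
        fix p
        show "cmod (z x p - z (x(B := y B)) p) \<le> 2 * r"
          using norm_triangle_ineq4[of "z x p" "z (x(B := y B)) p"] zr[of x p] zr[of "x(B := y B)" p] by linarith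
      qed
      also have "\<dots> = 2 * r * (\<Sum>p\<in>B. u p)" unfolding sum_distrib_right[symmetric] by simp
      finally have "max 0 (g x - g (x(B := y B))) \<le> 2 * r * (\<Sum>p\<in>B. u p)"
        using r by (simp add: sum_nonneg u0)
      then have "(max 0 (g x - g (x(B := y B))))\<^sup>2 \<le> (2 * r * (\<Sum>p\<in>B. u p))\<^sup>2"
        by (intro power_mono) auto
      also have "\<dots> = 4 * r\<^sup>2 * (\<Sum>p\<in>B. u p)\<^sup>2" by (simp add: power_mult_distrib)
      also have "\<dots> \<le> 4 * r\<^sup>2 * ((\<Sum>p\<in>B. (u p)\<^sup>2) * real d)"
      proof (intro mult_left_mono)
        \<comment> \<open>Cauchy-Schwarz on one block; this is where the block size \<open>d\<close>
          enters the variance.\<close>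
        have "(\<Sum>p\<in>B. u p)\<^sup>2 \<le> (\<Sum>p\<in>B. (u p)\<^sup>2) * real (card B)"
          by (rule sum_squared_le_sum_of_squares)
        also have "\<dots> \<le> (\<Sum>p\<in>B. (u p)\<^sup>2) * real d"
          using card[OF BP] by (intro mult_left_mono sum_nonneg) auto
        finally show "(\<Sum>p\<in>B. u p)\<^sup>2 \<le> (\<Sum>p\<in>B. (u p)\<^sup>2) * real d" .
      qed simp
      finally show ?thesis by (simp add: mult_ac)
    qed
    have "(\<Sum>B\<in>P. (max 0 (g x - g (x(B := y B))))\<^sup>2) \<le> (\<Sum>B\<in>P. 4 * r\<^sup>2 * real d * (\<Sum>p\<in>B. (u p)\<^sup>2))"
      by (intro sum_mono B)
    also have "\<dots> = 4 * r\<^sup>2 * real d * (\<Sum>p\<in>?I. (u p)\<^sup>2)"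
      by (simp only: sumP sum_distrib_left)
    also have "\<dots> \<le> 4 * r\<^sup>2 * real d * (1 / (real n)\<^sup>2)"
      by (intro mult_left_mono u2) simp
    finally show "(\<Sum>B\<in>P. (max 0 (g x - g (x(B := y B))))\<^sup>2) \<le> 4 * r\<^sup>2 * real d / (real n)\<^sup>2" by simp
  qed
  moreover have "g (\<lambda>B\<in>P. restrict (\<lambda>ij. X \<omega> $$ ij) B) = abs_stat n t (\<lambda>p. trunc r (entries n (X \<omega>) p))" for \<omega>
  proof -
    have "z (\<lambda>B\<in>P. restrict (\<lambda>ij. X \<omega> $$ ij) B) p = trunc r (entries n (X \<omega>) p)" for p
      using blk'[of p] r by (auto simp: z_def entries_def trunc_def)
    then have "z (\<lambda>B\<in>P. restrict (\<lambda>ij. X \<omega> $$ ij) B) = (\<lambda>p. trunc r (entries n (X \<omega>) p))"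
      by (rule ext)
    then show ?thesis by (simp only: g_def)
  qed
  ultimately show ?thesis by simp
qed

lemma (in prob_space) abs_deviation_le_sqrt_variance:
  fixes Y :: "'a \<Rightarrow> real"
  assumes [measurable]: "Y \<in> borel_measurable M" and bdd: "\<And>\<omega>. \<omega> \<in> space M \<Longrightarrow> \<bar>Y \<omega>\<bar> \<le> C"
  shows "expectation (\<lambda>\<omega>. \<bar>Y \<omega> - expectation Y\<bar>) \<le> sqrt (variance Y)"
proof -
  let ?D = "\<lambda>\<omega>. \<bar>Y \<omega> - expectation Y\<bar>"
  define C' where "C' = C + \<bar>expectation Y\<bar>"
  have D: "?D \<omega> \<le> C'" if "\<omega> \<in> space M" for \<omega> using bdd[OF that] unfolding C'_def by linarith
  have i1: "integrable M ?D"
    by (rule integrable_const_bound[of _ C']) (auto intro!: AE_I2 D)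
  have i2: "integrable M (\<lambda>\<omega>. (?D \<omega>)\<^sup>2)"
  proof (rule integrable_const_bound[of _ "C'\<^sup>2"])
    show "AE \<omega> in M. norm ((?D \<omega>)\<^sup>2) \<le> C'\<^sup>2"
    proof (intro AE_I2)
      fix \<omega> assume "\<omega> \<in> space M"
      then have "(?D \<omega>)\<^sup>2 \<le> C'\<^sup>2" by (intro power_mono D) auto
      then show "norm ((?D \<omega>)\<^sup>2) \<le> C'\<^sup>2" by simp
    qed
  qed measurable
  \<comment> \<open>Jensen's inequality in the form that the absolute deviation itself has
    nonnegative variance.\<close>
  have "0 \<le> variance ?D" by (rule variance_positive)
  also have "variance ?D = expectation (\<lambda>\<omega>. (?D \<omega>)\<^sup>2) - (expectation ?D)\<^sup>2"
    by (rule variance_eq[OF i1 i2])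
  finally show ?thesis by (intro real_le_rsqrt) simp
qed

text \<open>Replacing \<open>Z\<close> by \<open>W\<close> costs the \<open>L^1\<close> distance
  twice, once for the variable and once for its mean.\<close>

lemma (in prob_space) abs_deviation_perturb:
  fixes Z W :: "'a \<Rightarrow> real"
  assumes Z: "integrable M Z" and W: "integrable M W"
  shows "expectation (\<lambda>\<omega>. \<bar>Z \<omega> - expectation Z\<bar>)
    \<le> 2 * expectation (\<lambda>\<omega>. \<bar>Z \<omega> - W \<omega>\<bar>) + expectation (\<lambda>\<omega>. \<bar>W \<omega> - expectation W\<bar>)"
proof -
  have ZW: "integrable M (\<lambda>\<omega>. \<bar>Z \<omega> - W \<omega>\<bar>)" and WW: "integrable M (\<lambda>\<omega>. \<bar>W \<omega> - expectation W\<bar>)"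
    and ZZ: "integrable M (\<lambda>\<omega>. \<bar>Z \<omega> - expectation Z\<bar>)"
    by (intro integrable_abs Bochner_Integration.integrable_diff Z W integrable_const)+
  have "\<bar>expectation W - expectation Z\<bar> = \<bar>expectation (\<lambda>\<omega>. Z \<omega> - W \<omega>)\<bar>"
    by (simp add: Z W Bochner_Integration.integral_diff)
  also have "\<dots> \<le> expectation (\<lambda>\<omega>. \<bar>Z \<omega> - W \<omega>\<bar>)" by (rule integral_abs_bound)
  finally have e: "\<bar>expectation W - expectation Z\<bar> \<le> expectation (\<lambda>\<omega>. \<bar>Z \<omega> - W \<omega>\<bar>)" .
  have "expectation (\<lambda>\<omega>. \<bar>Z \<omega> - expectation Z\<bar>) \<le>
      expectation (\<lambda>\<omega>. (\<bar>Z \<omega> - W \<omega>\<bar> + \<bar>W \<omega> - expectation W\<bar>) + \<bar>expectation W - expectation Z\<bar>)"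
    by (intro integral_mono ZZ Bochner_Integration.integrable_add ZW WW integrable_const) linarith
  also have "\<dots> = (expectation (\<lambda>\<omega>. \<bar>Z \<omega> - W \<omega>\<bar>) + expectation (\<lambda>\<omega>. \<bar>W \<omega> - expectation W\<bar>))
      + \<bar>expectation W - expectation Z\<bar>"
    using ZW WW by (simp add: prob_space)
  finally show ?thesis using e by linarith
qed

lemma (in prob_space) abs_deviation_sum:
  fixes Y :: "'j \<Rightarrow> 'a \<Rightarrow> real"
  assumes "\<And>j. j \<in> J \<Longrightarrow> integrable M (Y j)"
  shows "expectation (\<lambda>\<omega>. \<bar>(\<Sum>j\<in>J. c j * Y j \<omega>) - expectation (\<lambda>\<omega>. \<Sum>j\<in>J. c j * Y j \<omega>)\<bar>)
    \<le> (\<Sum>j\<in>J. \<bar>c j\<bar> * expectation (\<lambda>\<omega>. \<bar>Y j \<omega> - expectation (Y j)\<bar>))"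
proof -
  have "expectation (\<lambda>\<omega>. \<Sum>j\<in>J. c j * Y j \<omega>) = (\<Sum>j\<in>J. c j * expectation (Y j))"
    using assms by (subst Bochner_Integration.integral_sum) auto
  then have "expectation (\<lambda>\<omega>. \<bar>(\<Sum>j\<in>J. c j * Y j \<omega>) - expectation (\<lambda>\<omega>. \<Sum>j\<in>J. c j * Y j \<omega>)\<bar>)
      = expectation (\<lambda>\<omega>. \<bar>\<Sum>j\<in>J. c j * (Y j \<omega> - expectation (Y j))\<bar>)"
    by (simp add: sum_subtractf right_diff_distrib)
  also have "\<dots> \<le> expectation (\<lambda>\<omega>. \<Sum>j\<in>J. \<bar>c j\<bar> * \<bar>Y j \<omega> - expectation (Y j)\<bar>)"
  proof (rule integral_mono)
    show "integrable M (\<lambda>\<omega>. \<bar>\<Sum>j\<in>J. c j * (Y j \<omega> - expectation (Y j))\<bar>)"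
      using assms by auto
    show "integrable M (\<lambda>\<omega>. \<Sum>j\<in>J. \<bar>c j\<bar> * \<bar>Y j \<omega> - expectation (Y j)\<bar>)"
      using assms by auto
    show "\<bar>\<Sum>j\<in>J. c j * (Y j \<omega> - expectation (Y j))\<bar> \<le> (\<Sum>j\<in>J. \<bar>c j\<bar> * \<bar>Y j \<omega> - expectation (Y j)\<bar>)" for \<omega>
      by (rule order.trans[OF sum_abs]) (simp add: abs_mult)
  qed
  also have "\<dots> = (\<Sum>j\<in>J. \<bar>c j\<bar> * expectation (\<lambda>\<omega>. \<bar>Y j \<omega> - expectation (Y j)\<bar>))"
    using assms by (subst Bochner_Integration.integral_sum) auto
  finally show ?thesis .
qed

section \<open>Measurability of the spectral statistics and the deviation bound for fixed
  \<open>n\<close>\<close>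

lemma abs_stat_entries_measurable:
  assumes n: "n > 0" and meas: "\<And>i j. i < n \<Longrightarrow> j < n \<Longrightarrow> (\<lambda>\<omega>. X \<omega> $$ (i, j)) \<in> borel_measurable M"
    and \<phi>: "\<phi> \<in> borel_measurable borel"
  shows "(\<lambda>\<omega>. abs_stat n t (\<lambda>p. \<phi> (entries n (X \<omega>) p))) \<in> borel_measurable M"
proof (rule measurable_compose[OF _ abs_stat_measurable[OF n]])
  have "(\<lambda>\<omega>. entries n (X \<omega>) p) \<in> borel_measurable M" for p
    using meas[of "fst p" "snd p"] by (cases "p \<in> {..<n} \<times> {..<n}") (auto simp: entries_def)
  then have "(\<lambda>\<omega>. \<phi> (entries n (X \<omega>) p)) \<in> borel_measurable M" for p
    using \<phi> by (rule measurable_compose)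
  then show "(\<lambda>\<omega> p. \<phi> (entries n (X \<omega>) p)) \<in> M \<rightarrow>\<^sub>M Pi\<^sub>M UNIV (\<lambda>_. borel)"
    by (rule measurable_abs_UNIV)
qed

text \<open>The integral is a pointwise limit of combinations of the measurable statistics
  \<open>abs_stat\<close>, taken along approximations of \<open>f\<close> with error
  \<open>1 / (m + 1)\<close>; no measurable choice of eigenvalues enters.\<close>

lemma esd_integral_measurable:
  fixes X :: "'a \<Rightarrow> complex mat"
  assumes n: "n > 0" and meas: "\<And>i j. i < n \<Longrightarrow> j < n \<Longrightarrow> (\<lambda>\<omega>. X \<omega> $$ (i, j)) \<in> borel_measurable M"
    and herm: "\<And>\<omega>. \<omega> \<in> space M \<Longrightarrow> hermitian_mat n (X \<omega>)"
    and lip: "1-lipschitz_on UNIV f" and supp: "compact (closure {x. f x \<noteq> 0})"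
  shows "(\<lambda>\<omega>. esd_integral f ((1 / sqrt (real n)) \<cdot>\<^sub>m X \<omega>)) \<in> borel_measurable M"
proof -
  have "\<exists>J c t. finite (J :: (int \<times> int) set) \<and>
      (\<forall>x. \<bar>f x - (\<Sum>j\<in>J. c j * \<bar>x - t j\<bar>)\<bar> \<le> inverse (real (Suc m)))" for m
    by (rule lipschitz_compact_support_abs_approx[OF lip supp, of "inverse (real (Suc m))"]) (simp, blast)
  then obtain J :: "nat \<Rightarrow> (int \<times> int) set" and c t
    where approx: "\<And>m x. \<bar>f x - (\<Sum>j\<in>J m. c m j * \<bar>x - t m j\<bar>)\<bar> \<le> inverse (real (Suc m))"
    by metis
  show ?thesis
  proof (rule borel_measurable_LIMSEQ_real)
    show "(\<lambda>\<omega>. \<Sum>j\<in>J m. c m j * abs_stat n (t m j) (entries n (X \<omega>))) \<in> borel_measurable M" for m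
      using abs_stat_entries_measurable[OF n meas, where \<phi> = "\<lambda>z. z"] by simp
    fix \<omega> assume \<omega>: "\<omega> \<in> space M"
    let ?e = "esd_integral f ((1 / sqrt (real n)) \<cdot>\<^sub>m X \<omega>)"
    let ?s = "\<lambda>m. \<Sum>j\<in>J m. c m j * abs_stat n (t m j) (entries n (X \<omega>))"
    have "norm (?s m - ?e) \<le> inverse (real (Suc m))" for m
      using esd_integral_abs_approx[OF hermitian_smult[OF herm[OF \<omega>], of "1 / sqrt (real n)"] n approx, of m]
      by (simp only: abs_stat_entries[OF herm[OF \<omega>]] real_norm_def abs_minus_commute)
    then have "(\<lambda>m. ?s m - ?e) \<longlonglongrightarrow> 0"
      by (intro Lim_null_comparison[OF _ LIMSEQ_inverse_real_of_nat] always_eventually) auto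
    then show "?s \<longlonglongrightarrow> ?e" by (rule LIM_zero_cancel)
  qed
qed

text \<open>\<open>Z\<close> is compared with \<open>W\<close>, the approximating combination at the
  truncated array. Off \<open>bad\<close> they differ by \<open>\<delta>\<close> from the
  approximation plus \<open>C * sqrt \<epsilon>\<close> from the truncation; on \<open>bad\<close>
  the crude bounds give \<open>2 * F + \<delta>\<close>. The last term bounds the fluctuation of
  \<open>W\<close>.\<close>

lemma (in prob_space) esd_integral_abs_deviation:
  fixes X :: "'a \<Rightarrow> complex mat"
  assumes n: "n > 0" and meas: "\<And>i j. i < n \<Longrightarrow> j < n \<Longrightarrow> (\<lambda>\<omega>. X \<omega> $$ (i, j)) \<in> borel_measurable M"
    and herm: "\<And>\<omega>. \<omega> \<in> space M \<Longrightarrow> hermitian_mat n (X \<omega>)"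
    and S: "prop_S M n n X d"
    and lip: "1-lipschitz_on UNIV f" and supp: "compact (closure {x. f x \<noteq> 0})"
    and F: "\<And>x. \<bar>f x\<bar> \<le> F"
    and J: "finite J" and approx: "\<And>x. \<bar>f x - (\<Sum>j\<in>J. c j * \<bar>x - t j\<bar>)\<bar> \<le> \<delta>"
    and \<epsilon>: "0 < \<epsilon>" and a: "0 < a"
  defines "Z \<equiv> \<lambda>\<omega>. esd_integral f ((1 / sqrt (real n)) \<cdot>\<^sub>m X \<omega>)"
    and "bad \<equiv> {\<omega> \<in> space M. (1 / real n ^ 2) * (\<Sum>i<n. \<Sum>j<n.
          (cmod (X \<omega> $$ (i, j)))\<^sup>2 * (if cmod (X \<omega> $$ (i, j)) > \<epsilon> * a then 1 else 0)) > \<epsilon>}"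
    and "C \<equiv> \<Sum>j\<in>J. \<bar>c j\<bar>"
  shows "integrable M Z"
    and "expectation (\<lambda>\<omega>. \<bar>Z \<omega> - expectation Z\<bar>)
      \<le> 2 * (\<delta> + C * sqrt \<epsilon> + (2 * F + \<delta>) * prob bad) + C * sqrt (4 * (\<epsilon> * a)\<^sup>2 * real d / (real n)\<^sup>2)"
proof -
  let ?I = "{..<n} \<times> {..<n}"
  let ?c = "1 / sqrt (real n)"
  have F0: "0 \<le> F" using F[of 0] by linarith
  have \<delta>0: "0 \<le> \<delta>" using approx[of 0] by linarith
  have C0: "0 \<le> C" by (simp add: C_def sum_nonneg)
  define r where "r = \<epsilon> * a"
  have r: "0 \<le> r" using \<epsilon> a by (simp add: r_def)
  have hX: "hermitian_mat n (of_real ?c \<cdot>\<^sub>m X \<omega>)" if "\<omega> \<in> space M" for \<omega>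
    by (rule hermitian_smult[OF herm[OF that]])
  define x where "x \<omega> = entries n (X \<omega>)" for \<omega>
  define y where "y \<omega> = (\<lambda>p. trunc r (x \<omega> p))" for \<omega>
  define Y where "Y j \<omega> = abs_stat n (t j) (y \<omega>)" for j \<omega>
  define W where "W \<omega> = (\<Sum>j\<in>J. c j * Y j \<omega>)" for \<omega>
  have Z_meas [measurable]: "Z \<in> borel_measurable M"
    unfolding Z_def by (rule esd_integral_measurable[OF n meas herm lip supp])
  have Z_bdd: "\<bar>Z \<omega>\<bar> \<le> F" if "\<omega> \<in> space M" for \<omega>
    unfolding Z_def by (rule esd_integral_bounded[OF hX[OF that] n F])
  show Z_int: "integrable M Z"
    by (rule integrable_const_bound[of _ F]) (auto intro!: AE_I2 Z_bdd)
  have Y_meas [measurable]: "Y j \<in> borel_measurable M" for j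
    unfolding Y_def y_def x_def by (rule abs_stat_entries_measurable[OF n meas trunc_measurable])
  have Y_bdd: "\<bar>Y j \<omega>\<bar> \<le> \<bar>abs_stat n (t j) (\<lambda>_. 0)\<bar> + r" for j \<omega>
    unfolding Y_def by (rule abs_stat_bounded[OF n r]) (simp add: y_def norm_trunc r)
  have Y_int: "integrable M (Y j)" for j
    by (rule integrable_const_bound[of _ "\<bar>abs_stat n (t j) (\<lambda>_. 0)\<bar> + r"]) (auto intro!: AE_I2 Y_bdd)
  have W_int: "integrable M W"
    unfolding W_def using Y_int by auto
  have meas' [measurable]: "(\<lambda>\<omega>. X \<omega> $$ (i, j)) \<in> borel_measurable M" if "i \<in> {..<n}" "j \<in> {..<n}" for i j
    using meas that by auto
  have bad [measurable]: "bad \<in> sets M"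
    unfolding bad_def by measurable
  \<comment> \<open>\<open>W\<close> is within \<open>\<delta>\<close> of the integral of
    \<open>f\<close> for the scaled Hermitian part of the truncated array, which gives a bound
    independent of the size of the \<open>c j\<close>.\<close>
  have WF: "\<bar>W \<omega>\<bar> \<le> F + \<delta>" for \<omega>
  proof -
    have h: "hermitian_mat n (of_real ?c \<cdot>\<^sub>m hpart n (y \<omega>))"
      by (rule hermitian_smult[OF hermitian_hpart])
    have "W \<omega> = (\<Sum>j\<in>J. c j * esd_integral (\<lambda>z. \<bar>z - t j\<bar>) (of_real ?c \<cdot>\<^sub>m hpart n (y \<omega>)))"
      by (simp add: W_def Y_def abs_stat_def)
    then show ?thesis
      using esd_integral_abs_approx[OF h n approx] esd_integral_bounded[OF h n, where f = f and F = F, OF F] by linarith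
  qed
  have ZW_good: "\<bar>Z \<omega> - W \<omega>\<bar> \<le> \<delta> + C * sqrt \<epsilon>" if \<omega>: "\<omega> \<in> space M" "\<omega> \<notin> bad" for \<omega>
  proof -
    have 1: "\<bar>Z \<omega> - (\<Sum>j\<in>J. c j * abs_stat n (t j) (x \<omega>))\<bar> \<le> \<delta>"
      using esd_integral_abs_approx[OF hX[OF \<omega>(1)] n approx]
      by (simp add: Z_def x_def abs_stat_entries[OF herm[OF \<omega>(1)]])
    \<comment> \<open>Truncation at \<open>\<epsilon> * a\<close> removes exactly the entries summed
      in \<open>bad\<close>, so off \<open>bad\<close> the squared distance of the arrays is at most
      \<open>\<epsilon> * n^2\<close>.\<close>
    have "(\<Sum>p\<in>?I. (cmod (x \<omega> p - y \<omega> p))\<^sup>2) = (\<Sum>i<n. \<Sum>j<n. (cmod (X \<omega> $$ (i, j)))\<^sup>2 *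
        (if cmod (X \<omega> $$ (i, j)) > \<epsilon> * a then 1 else 0))"
      unfolding sum.cartesian_product
      by (intro sum.cong) (auto simp: x_def y_def entries_def trunc_def r_def)
    also have "\<dots> \<le> \<epsilon> * (real n)\<^sup>2"
      using \<omega> n by (simp add: bad_def not_less field_simps)
    finally have "sqrt (\<Sum>p\<in>?I. (cmod (x \<omega> p - y \<omega> p))\<^sup>2) \<le> sqrt (\<epsilon> * (real n)\<^sup>2)"
      by (rule real_sqrt_le_mono)
    also have "\<dots> = sqrt \<epsilon> * real n" by (simp add: real_sqrt_mult)
    finally have 2: "sqrt (\<Sum>p\<in>?I. (cmod (x \<omega> p - y \<omega> p))\<^sup>2) / real n \<le> sqrt \<epsilon>"
      using n by (simp add: field_simps)
    have "\<bar>(\<Sum>j\<in>J. c j * abs_stat n (t j) (x \<omega>)) - W \<omega>\<bar> =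
        \<bar>\<Sum>j\<in>J. c j * (abs_stat n (t j) (x \<omega>) - abs_stat n (t j) (y \<omega>))\<bar>"
      by (simp add: W_def Y_def sum_subtractf right_diff_distrib)
    also have "\<dots> \<le> (\<Sum>j\<in>J. \<bar>c j\<bar> * sqrt \<epsilon>)"
    proof (rule order.trans[OF sum_abs], rule sum_mono)
      fix j
      have "\<bar>abs_stat n (t j) (x \<omega>) - abs_stat n (t j) (y \<omega>)\<bar> \<le> sqrt \<epsilon>"
        using abs_stat_lipschitz[OF n] 2 by (rule order.trans)
      then show "\<bar>c j * (abs_stat n (t j) (x \<omega>) - abs_stat n (t j) (y \<omega>))\<bar> \<le> \<bar>c j\<bar> * sqrt \<epsilon>"
        unfolding abs_mult by (intro mult_left_mono) auto
    qed
    also have "\<dots> = C * sqrt \<epsilon>" by (simp add: C_def sum_distrib_right)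
    finally show ?thesis using 1 by linarith
  qed
  have ZW: "\<bar>Z \<omega> - W \<omega>\<bar> \<le> (\<delta> + C * sqrt \<epsilon>) + (2 * F + \<delta>) * indicator bad \<omega>" if "\<omega> \<in> space M" for \<omega>
  proof (cases "\<omega> \<in> bad")
    case True
    have "0 \<le> C * sqrt \<epsilon>" using C0 \<epsilon> by simp
    then show ?thesis using True Z_bdd[OF that] WF[of \<omega>] \<delta>0 by (simp add: abs_le_iff)
  next
    case False
    then show ?thesis using ZW_good[OF that] by simp
  qed
  have "expectation (\<lambda>\<omega>. \<bar>Z \<omega> - W \<omega>\<bar>) \<le> expectation (\<lambda>\<omega>. (\<delta> + C * sqrt \<epsilon>) + (2 * F + \<delta>) * indicator bad \<omega>)"
  proof (rule integral_mono[OF _ _ ZW])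
    show "integrable M (\<lambda>\<omega>. \<bar>Z \<omega> - W \<omega>\<bar>)" using Z_int W_int by auto
    show "integrable M (\<lambda>\<omega>. (\<delta> + C * sqrt \<epsilon>) + (2 * F + \<delta>) * indicator bad \<omega>)"
      by (intro Bochner_Integration.integrable_add integrable_const integrable_mult_right integrable_real_indicator bad)
        (simp add: less_top[symmetric])
  qed
  also have "\<dots> = \<delta> + C * sqrt \<epsilon> + (2 * F + \<delta>) * prob bad"
    by (subst Bochner_Integration.integral_add) (auto simp: prob_space less_top[symmetric])
  finally have E1: "expectation (\<lambda>\<omega>. \<bar>Z \<omega> - W \<omega>\<bar>) \<le> \<delta> + C * sqrt \<epsilon> + (2 * F + \<delta>) * prob bad" .
  have "expectation (\<lambda>\<omega>. \<bar>W \<omega> - expectation W\<bar>) \<le> (\<Sum>j\<in>J. \<bar>c j\<bar> * expectation (\<lambda>\<omega>. \<bar>Y j \<omega> - expectation (Y j)\<bar>))"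
    unfolding W_def by (rule abs_deviation_sum[OF Y_int])
  also have "\<dots> \<le> (\<Sum>j\<in>J. \<bar>c j\<bar> * sqrt (4 * r\<^sup>2 * real d / (real n)\<^sup>2))"
  proof (intro sum_mono mult_left_mono)
    fix j
    have "expectation (\<lambda>\<omega>. \<bar>Y j \<omega> - expectation (Y j)\<bar>) \<le> sqrt (variance (Y j))"
      by (rule abs_deviation_le_sqrt_variance[OF Y_meas Y_bdd])
    also have "\<dots> \<le> sqrt (4 * r\<^sup>2 * real d / (real n)\<^sup>2)"
      using variance_abs_stat_trunc[OF n r S, of "t j"] unfolding Y_def y_def x_def by (rule real_sqrt_le_mono)
    finally show "expectation (\<lambda>\<omega>. \<bar>Y j \<omega> - expectation (Y j)\<bar>) \<le> sqrt (4 * r\<^sup>2 * real d / (real n)\<^sup>2)" .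
  qed simp
  also have "\<dots> = C * sqrt (4 * r\<^sup>2 * real d / (real n)\<^sup>2)" by (simp only: C_def sum_distrib_right)
  finally have E2: "expectation (\<lambda>\<omega>. \<bar>W \<omega> - expectation W\<bar>) \<le> C * sqrt (4 * r\<^sup>2 * real d / (real n)\<^sup>2)" .
  show "expectation (\<lambda>\<omega>. \<bar>Z \<omega> - expectation Z\<bar>)
      \<le> 2 * (\<delta> + C * sqrt \<epsilon> + (2 * F + \<delta>) * prob bad) + C * sqrt (4 * (\<epsilon> * a)\<^sup>2 * real d / (real n)\<^sup>2)"
    by (rule order.trans[OF abs_deviation_perturb[OF Z_int W_int]], intro add_mono mult_left_mono E1 E2[unfolded r_def]) simp
qed

section \<open>Passage to the limit and convergence in probability\<close>

lemma limsup_ereal_eq_0_imp_tendsto: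
  fixes p :: "nat \<Rightarrow> real"
  assumes "\<And>n. 0 \<le> p n" "limsup (\<lambda>n. ereal (p n)) = 0"
  shows "p \<longlonglongrightarrow> 0"
proof -
  have "0 \<le> liminf (\<lambda>n. ereal (p n))" by (rule Liminf_bounded) (simp add: assms(1))
  then have "((\<lambda>n. ereal (p n)) \<longlongrightarrow> 0) sequentially"
    using assms(2) Liminf_le_Limsup[of sequentially "\<lambda>n. ereal (p n)"]
    by (subst tendsto_iff_Liminf_eq_Limsup) auto
  then show ?thesis by (simp add: zero_ereal_def)
qed

theorem theorem2p12:
  fixes M :: "nat \<Rightarrow> 'a measure"
    and X :: "nat \<Rightarrow> 'a \<Rightarrow> complex mat"
    and a :: "nat \<Rightarrow> real"
    and d :: "nat \<Rightarrow> nat"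
    and f :: "real \<Rightarrow> real"
  assumes prob: "\<And>n. prob_space (M n)"
    and meas: "\<And>n i j. i < n \<Longrightarrow> j < n \<Longrightarrow> (\<lambda>\<omega>. X n \<omega> $$ (i, j)) \<in> borel_measurable (M n)"
    and herm: "\<And>n \<omega>. \<omega> \<in> space (M n) \<Longrightarrow> hermitian_mat n (X n \<omega>)"
    and a_pos: "\<And>n. a n > 0"
    and a_lim: "filterlim a at_top sequentially"
    and S: "\<And>n. prop_S (M n) n n (X n) (d n)"
    and d_bound: "(\<lambda>n. real (d n)) \<in> O(\<lambda>n. real n ^ 2 / (a n) ^ 2)"
    and L: "prop_L M X a"
    and f_cont: "continuous_on UNIV f"
    and f_supp: "compact (closure {x. f x \<noteq> 0})"
    and f_lip: "1-lipschitz_on UNIV f"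
  shows "\<forall>\<epsilon>>0. (\<lambda>n. measure (M n) {\<omega> \<in> space (M n).
            \<bar>esd_integral f ((1 / sqrt (real n)) \<cdot>\<^sub>m X n \<omega>)
             - integral\<^sup>L (M n) (\<lambda>\<omega>'. esd_integral f ((1 / sqrt (real n)) \<cdot>\<^sub>m X n \<omega>'))\<bar> > \<epsilon>})
          \<longlonglongrightarrow> 0"
proof -
  define Z where "Z n \<omega> = esd_integral f ((1 / sqrt (real n)) \<cdot>\<^sub>m X n \<omega>)" for n \<omega>
  define dev where "dev n = (\<integral>\<omega>. \<bar>Z n \<omega> - integral\<^sup>L (M n) (Z n)\<bar> \<partial>M n)" for n
  obtain F where F: "\<And>x. \<bar>f x\<bar> \<le> F"
  proof -
    have "bounded (f ` closure {x. f x \<noteq> 0})"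
      by (intro compact_imp_bounded compact_continuous_image f_supp continuous_on_subset[OF f_cont]) simp
    then obtain B where B: "\<And>x. x \<in> closure {x. f x \<noteq> 0} \<Longrightarrow> \<bar>f x\<bar> \<le> B"
      by (auto simp: bounded_iff)
    have "\<bar>f x\<bar> \<le> max B 0" for x
      using B[of x] closure_subset[of "{x. f x \<noteq> 0}"] by (cases "f x = 0") auto
    then show thesis by (rule that)
  qed
  obtain D where D: "D > 0" "\<forall>\<^sub>F n in sequentially. real (d n) \<le> D * (real n ^ 2 / (a n) ^ 2)"
    using d_bound by (auto elim!: landau_o.bigE)
  have dev_nonneg: "0 \<le> dev n" for n by (simp add: dev_def)
  have Z_int: "integrable (M n) (Z n)" if "n > 0" for n
  proof -
    interpret prob_space "M n" by (rule prob)
    \<comment> \<open>The integrability conclusion does not involve the approximation and truncation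
      parameters, so all of them are set to \<open>1\<close>.\<close>
    have one: "(0 :: real) < 1" by simp
    obtain J :: "(int \<times> int) set" and c t where "finite J" "\<And>x. \<bar>f x - (\<Sum>j\<in>J. c j * \<bar>x - t j\<bar>)\<bar> \<le> 1"
      using lipschitz_compact_support_abs_approx[OF f_lip f_supp one] by blast
    from esd_integral_abs_deviation(1)[OF that meas herm S f_lip f_supp F this one one]
    show ?thesis unfolding Z_def by simp
  qed
  have dev_lim: "dev \<longlonglongrightarrow> 0"
  proof (rule LIMSEQ_I)
    fix \<kappa> :: real assume \<kappa>: "0 < \<kappa>"
    \<comment> \<open>The term \<open>2 * \<delta>\<close> takes one quarter of
      \<open>\<kappa>\<close>; the \<open>sqrt \<epsilon>\<close> terms and the bad event take
      another quarter each.\<close>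
    define \<delta> where "\<delta> = \<kappa> / 8"
    have \<delta>: "\<delta> > 0" using \<kappa> by (simp add: \<delta>_def)
    obtain J :: "(int \<times> int) set" and c t where J: "finite J"
      and approx: "\<And>x. \<bar>f x - (\<Sum>j\<in>J. c j * \<bar>x - t j\<bar>)\<bar> \<le> \<delta>"
      using lipschitz_compact_support_abs_approx[OF f_lip f_supp \<delta>] by blast
    define C where "C = (\<Sum>j\<in>J. \<bar>c j\<bar>)"
    have C0: "0 \<le> C" by (simp add: C_def sum_nonneg)
    \<comment> \<open>Collects the truncation and variance terms as a multiple of
      \<open>sqrt \<epsilon>\<close>; using \<open>C + 1\<close> keeps \<open>Q\<close> positive
      when \<open>C = 0\<close>.\<close>
    define Q where "Q = 2 * (C + 1) * (1 + sqrt D)"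
    have Q: "Q > 0" unfolding Q_def using C0 D by (intro mult_pos_pos add_nonneg_pos add_pos_nonneg) auto
    \<comment> \<open>The bound by \<open>1\<close> gives
      \<open>\<epsilon> \<le> sqrt \<epsilon>\<close>; the other one gives
      \<open>Q * sqrt \<epsilon> \<le> \<kappa> / 4\<close>.\<close>
    define \<epsilon> where "\<epsilon> = min 1 ((\<kappa> / (4 * Q))\<^sup>2)"
    have \<epsilon>: "0 < \<epsilon>" "\<epsilon> \<le> 1" using \<kappa> Q by (auto simp: \<epsilon>_def)
    have "sqrt \<epsilon> \<le> \<kappa> / (4 * Q)"
      using \<kappa> Q by (intro real_le_lsqrt) (auto simp: \<epsilon>_def)
    then have Qe: "Q * sqrt \<epsilon> \<le> \<kappa> / 4" using Q by (simp add: field_simps)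
    have e_le: "\<epsilon> \<le> sqrt \<epsilon>"
      using \<epsilon> by (intro real_le_rsqrt) (simp add: power2_eq_square mult_le_cancel_left1)
    define bad where "bad n = {\<omega> \<in> space (M n). (1 / real n ^ 2) * (\<Sum>i<n. \<Sum>j<n.
          (cmod (X n \<omega> $$ (i, j)))\<^sup>2 * (if cmod (X n \<omega> $$ (i, j)) > \<epsilon> * a n then 1 else 0)) > \<epsilon>}" for n
    have "(\<lambda>n. measure (M n) (bad n)) \<longlonglongrightarrow> 0"
      using L \<epsilon>(1) unfolding bad_def prop_L_def by (intro limsup_ereal_eq_0_imp_tendsto) auto
    then have "(\<lambda>n. 2 * (2 * F + \<delta>) * measure (M n) (bad n)) \<longlonglongrightarrow> 2 * (2 * F + \<delta>) * 0"
      by (intro tendsto_intros)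
    then have bad_ev: "\<forall>\<^sub>F n in sequentially. 2 * (2 * F + \<delta>) * measure (M n) (bad n) < \<kappa> / 4"
      using \<kappa> by (intro order_tendstoD(2)) auto
    have "\<forall>\<^sub>F n in sequentially. dev n < \<kappa>"
      using bad_ev D(2) eventually_gt_at_top[of 0]
    proof eventually_elim
      case (elim n)
      interpret prob_space "M n" by (rule prob)
      \<comment> \<open>The growth bound on \<open>d n\<close> cancels both \<open>a n\<close> and
        \<open>n\<close>, leaving a quantity controlled by \<open>\<epsilon>\<close> alone.\<close>
      have "4 * (\<epsilon> * a n)\<^sup>2 * real (d n) / (real n)\<^sup>2 \<le> 4 * (\<epsilon> * a n)\<^sup>2 * (D * ((real n)\<^sup>2 / (a n)\<^sup>2)) / (real n)\<^sup>2"
        using elim(2) by (intro divide_right_mono mult_left_mono) auto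
      also have "\<dots> = (2 * \<epsilon>)\<^sup>2 * D"
        using elim(3) a_pos[of n] by (simp add: power_mult_distrib field_simps)
      finally have "sqrt (4 * (\<epsilon> * a n)\<^sup>2 * real (d n) / (real n)\<^sup>2) \<le> sqrt ((2 * \<epsilon>)\<^sup>2 * D)"
        by (rule real_sqrt_le_mono)
      also have "\<dots> = 2 * \<epsilon> * sqrt D" using \<epsilon> by (simp add: real_sqrt_mult)
      also have "\<dots> \<le> 2 * sqrt \<epsilon> * sqrt D"
        using e_le D by (intro mult_right_mono) auto
      finally have v: "C * sqrt (4 * (\<epsilon> * a n)\<^sup>2 * real (d n) / (real n)\<^sup>2) \<le> C * (2 * sqrt \<epsilon> * sqrt D)"
        using C0 by (rule mult_left_mono)
      have "dev n \<le> 2 * (\<delta> + C * sqrt \<epsilon> + (2 * F + \<delta>) * prob (bad n))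
          + C * sqrt (4 * (\<epsilon> * a n)\<^sup>2 * real (d n) / (real n)\<^sup>2)"
        unfolding dev_def Z_def C_def bad_def
        by (rule esd_integral_abs_deviation(2)[OF elim(3) meas herm S f_lip f_supp F J approx \<epsilon>(1) a_pos])
      also have "\<dots> \<le> 2 * \<delta> + 2 * C * (1 + sqrt D) * sqrt \<epsilon> + 2 * (2 * F + \<delta>) * prob (bad n)"
        using v by (simp add: algebra_simps)
      also have "2 * C * (1 + sqrt D) * sqrt \<epsilon> \<le> Q * sqrt \<epsilon>"
        unfolding Q_def using C0 D \<epsilon> by (intro mult_right_mono mult_left_mono) auto
      finally have "dev n \<le> 2 * \<delta> + Q * sqrt \<epsilon> + 2 * (2 * F + \<delta>) * prob (bad n)" by simp
      also have "\<dots> < \<kappa> / 4 + \<kappa> / 4 + \<kappa> / 4"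
        using Qe elim(1) by (simp add: \<delta>_def)
      also have "\<dots> < \<kappa>" using \<kappa> by simp
      finally show "dev n < \<kappa>" .
    qed
    then show "\<exists>no. \<forall>n\<ge>no. norm (dev n - 0) < \<kappa>"
      by (simp add: eventually_sequentially dev_nonneg)
  qed
  show ?thesis
  proof (intro allI impI)
    fix \<epsilon> :: real assume \<epsilon>: "0 < \<epsilon>"
    have "\<forall>\<^sub>F n in sequentially. norm (measure (M n) {\<omega> \<in> space (M n). \<bar>Z n \<omega> - integral\<^sup>L (M n) (Z n)\<bar> > \<epsilon>}) \<le> dev n / \<epsilon>"
      using eventually_gt_at_top[of 0]
    proof eventually_elim
      case (elim n)
      interpret prob_space "M n" by (rule prob)
      have Zi: "integrable (M n) (\<lambda>\<omega>. \<bar>Z n \<omega> - expectation (Z n)\<bar>)" using Z_int[OF elim] by auto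
      have [measurable]: "Z n \<in> borel_measurable (M n)" using Z_int[OF elim] by auto
      have "prob {\<omega> \<in> space (M n). \<bar>Z n \<omega> - expectation (Z n)\<bar> > \<epsilon>}
          \<le> prob {\<omega> \<in> space (M n). \<bar>Z n \<omega> - expectation (Z n)\<bar> \<ge> \<epsilon>}"
        by (intro finite_measure_mono) auto
      \<comment> \<open>Markov's inequality turns the \<open>L^1\<close> convergence into
        convergence in probability.\<close>
      also have "\<dots> \<le> dev n / \<epsilon>"
        unfolding dev_def by (rule integral_Markov_inequality_measure[OF Zi sets.top _ \<epsilon>]) simp
      finally show ?case by simp
    qed
    moreover have "(\<lambda>n. dev n / \<epsilon>) \<longlonglongrightarrow> 0"
      using tendsto_divide[OF dev_lim tendsto_const[of \<epsilon>]] \<epsilon> by simp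
    ultimately have "(\<lambda>n. measure (M n) {\<omega> \<in> space (M n). \<bar>Z n \<omega> - integral\<^sup>L (M n) (Z n)\<bar> > \<epsilon>}) \<longlonglongrightarrow> 0"
      by (rule Lim_null_comparison)
    then show "(\<lambda>n. measure (M n) {\<omega> \<in> space (M n).
            \<bar>esd_integral f ((1 / sqrt (real n)) \<cdot>\<^sub>m X n \<omega>)
             - integral\<^sup>L (M n) (\<lambda>\<omega>'. esd_integral f ((1 / sqrt (real n)) \<cdot>\<^sub>m X n \<omega>'))\<bar> > \<epsilon>})
          \<longlonglongrightarrow> 0"
      unfolding Z_def .
  qed
qed

end
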